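(* Let $T\colon E\to F$ be an order bounded operator between Banach lattices. The following statements are equivalent: (1) $T$ is AM-compact; (2) $\widehat{T}$ maps $i_E$ into $F$; (3) there exists a map $\bar{T}\colon\check{E}\to\widetilde{F}$ such that $\widetilde{T}=\bar{T}\varphi_E$, i.e., $\widetilde{T}\tilde{x}=\bar{T}\check{x}$ for all $\tilde x\in\widetilde E$. Here $\widehat T\colon\widehat E\to\widehat F$ is the operator induced on nonstandard hulls, $i_E$ is the closed order ideal generated by $E$ in $\widehat E$, $\widetilde E=\widehat E/E$, $\widetilde F=\widehat F/F$, $\check E=\widehat E/i_E$, and $\varphi_E\colon\widetilde E\to\check E$ is the canonical epimorphism $\varphi_E(\tilde x)=\check x$.
   Context: Banach lattices are complex unless specified otherwise; operators are linear and bounded. $E_+$ is the positive cone and for $u\in E_+$, $[-u,u]=\{x\in E: |x|\le u\}$. An operator between Banach lattices is order bounded if it maps order intervals into order intervals. An order bounded operator is AM-compact if it maps order intervals into precompact (relatively compact) sets. Nonstandard hull: work in a nonstandard universe which is sufficiently saturated (any family of internal sets indexed by a standard set and having the finite intersection property has nonempty intersection). ${}^*E$ is the nonstandard extension of $E$; extensions of operators are denoted by the same letters. $\mathrm{fin}({}^*E)$ is the set of elements of finite norm, $\mu(0)$ the set of elements of infinitesimal norm, and $\widehat E=\mathrm{fin}({}^*E)/\mu(0)$; $\hat x$ is the class of $x$, $\|\hat x\|$ is the standard part of $\|x\|$. $\widehat E$ is a Banach lattice with $|\hat x|=\widehat{|x|}$, and $E$ is identified with a closed subspace of $\widehat E$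 via $x\mapsto\hat x$. $\widehat T\hat x=\widehat{Tx}$ defines $\widehat T\colon\widehat E\to\widehat F$. Quotients: $\widetilde E=\widehat E/E$, with $\tilde x$ the class of $\hat x$; $\widetilde T\colon\widetilde E\to\widetilde F$ is given by $\widetilde T\tilde x=\widetilde{Tx}$. $I(E)=\{\xi\in\widehat E: |\xi|\le \hat u\text{ for some }u\in E_+\}$ is the order ideal generated by $E$ in $\widehat E$, $i_E=\overline{I(E)}$ its norm closure, $\check E=\widehat E/i_E$, with $\check x$ the class of $\hat x$. Since $E\subseteq i_E$, $\varphi_E(\tilde x)=\check x$ is well defined. *)

theory Defs
  imports "HOL-Analysis.Analysis" "HOL-Library.Lattice_Algebras"
begin

section \<open>Complex Banach lattices\<close>

class banach_lattice = banach + ordered_real_vector + lattice_ab_group_add_abs +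
  assumes norm_mono_abs: "\<bar>x\<bar> \<le> \<bar>y\<bar> \<Longrightarrow> norm x \<le> norm y"

instance real :: banach_lattice
  by standard auto

text \<open>
  A complex Banach lattice is the complexification \<open>E\<^sub>\<real> + \<i>E\<^sub>\<real>\<close> of a real Banach lattice
  \<open>E\<^sub>\<real>\<close>, with modulus \<open>\<bar>x + \<i>y\<bar> = sup\<^sub>\<theta> (cos \<theta> x + sin \<theta> y)\<close> and norm \<open>\<parallel>z\<parallel> = \<parallel> \<bar>z\<bar> \<parallel>\<close>.
  The supremum exists by \<open>modulus_exists\<close> below.
\<close>

datatype 'a complexification = Complexification (re_part: 'a) (im_part: 'a)

definition rot :: "'a::banach_lattice complexification \<Rightarrow> real \<Rightarrow> 'a" where
  "rot z \<theta> = cos \<theta> *\<^sub>R re_part z + sin \<theta> *\<^sub>R im_part z"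

definition modulus :: "'a::banach_lattice complexification \<Rightarrow> 'a" where
  "modulus z = (THE m. (\<forall>\<theta>. rot z \<theta> \<le> m) \<and> (\<forall>n. (\<forall>\<theta>. rot z \<theta> \<le> n) \<longrightarrow> m \<le> n))"

lemma norm_abs_bl: "norm \<bar>x :: 'a::banach_lattice\<bar> = norm x"
  by (intro antisym norm_mono_abs) auto

lemma norm_mono_nonneg:
  fixes x y :: "'a::banach_lattice"
  assumes "0 \<le> x" "x \<le> y" shows "norm x \<le> norm y"
  using assms by (intro norm_mono_abs) (auto simp: abs_of_nonneg)

lemma abs_scaleR_bl: "\<bar>r *\<^sub>R x :: 'a::banach_lattice\<bar> \<le> \<bar>r\<bar> *\<^sub>R \<bar>x\<bar>"
proof (cases "r \<ge> 0")
  case True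
  have "r *\<^sub>R x \<le> r *\<^sub>R \<bar>x\<bar>" "r *\<^sub>R (- x) \<le> r *\<^sub>R \<bar>x\<bar>"
    using True by (intro scaleR_left_mono abs_ge_self abs_ge_minus_self; simp)+
  then show ?thesis using True by (intro abs_leI) simp_all
next
  case False
  have "(-r) *\<^sub>R x \<le> (-r) *\<^sub>R \<bar>x\<bar>" "(-r) *\<^sub>R (- x) \<le> (-r) *\<^sub>R \<bar>x\<bar>"
    using False by (intro scaleR_left_mono abs_ge_self abs_ge_minus_self; simp)+
  then show ?thesis using False by (intro abs_leI) simp_all
qed

lemma nonneg_limit_bl:
  fixes X :: "nat \<Rightarrow> 'a::banach_lattice"
  assumes lim: "X \<longlonglongrightarrow> x" and pos: "\<And>n. 0 \<le> X n"
  shows "0 \<le> x"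
proof -
  have key: "sup (- x) 0 \<le> \<bar>X n - x\<bar>" for n
  proof (rule sup_least)
    have "- x \<le> X n - x" using pos[of n] by simp
    also have "\<dots> \<le> \<bar>X n - x\<bar>" by (rule abs_ge_self)
    finally show "- x \<le> \<bar>X n - x\<bar>" .
  qed simp
  have "norm (sup (- x) 0) \<le> norm (X n - x)" for n
    using norm_mono_nonneg[OF _ key[of n]] by (simp add: norm_abs_bl)
  moreover have "(\<lambda>n. norm (X n - x)) \<longlonglongrightarrow> 0"
    using lim by (simp add: LIM_zero_iff tendsto_norm_zero)
  ultimately have "norm (sup (- x) 0) \<le> 0"
    by (intro LIMSEQ_le_const) auto
  then have "sup (- x) 0 = 0" by simp
  then have "- x \<le> 0" by (metis sup_ge1)
  then show ?thesis by simp
qed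

lemma le_limit_bl:
  fixes X :: "nat \<Rightarrow> 'a::banach_lattice"
  assumes "X \<longlonglongrightarrow> x" "Y \<longlonglongrightarrow> y" "\<And>n. X n \<le> Y n"
  shows "x \<le> y"
  using nonneg_limit_bl[of "\<lambda>n. Y n - X n" "y - x"] assms by (auto intro: tendsto_intros)

lemma rot_lipschitz:
  "rot z s \<le> rot z t + \<bar>s - t\<bar> *\<^sub>R (\<bar>re_part z\<bar> + \<bar>im_part z\<bar>)"
proof -
  have gen: "\<bar>2 * a * sin ((s - t) / 2)\<bar> \<le> \<bar>s - t\<bar>" if "\<bar>a\<bar> \<le> 1" for a
  proof -
    have "\<bar>a\<bar> * \<bar>sin ((s - t) / 2)\<bar> \<le> 1 * \<bar>(s - t) / 2\<bar>"
      using that by (intro mult_mono abs_sin_x_le_abs_x) auto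
    then show ?thesis by (simp add: abs_mult)
  qed
  have c: "\<bar>cos s - cos t\<bar> \<le> \<bar>s - t\<bar>"
  proof -
    have "cos s - cos t = 2 * sin ((s + t) / 2) * sin ((t - s) / 2)"
      by (simp add: cos_diff_cos)
    also have "sin ((t - s) / 2) = - sin ((s - t) / 2)"
      by (metis minus_diff_eq minus_divide_left sin_minus)
    finally show ?thesis using gen[of "sin ((s + t) / 2)"] by simp
  qed
  have d: "\<bar>sin s - sin t\<bar> \<le> \<bar>s - t\<bar>"
    using gen[of "cos ((s + t) / 2)"] by (simp add: sin_diff_sin mult.commute mult.left_commute)
  have le: "r *\<^sub>R x \<le> \<bar>s - t\<bar> *\<^sub>R \<bar>x\<bar>" if "\<bar>r\<bar> \<le> \<bar>s - t\<bar>" for r and x :: 'a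
  proof -
    have "r *\<^sub>R x \<le> \<bar>r *\<^sub>R x\<bar>" by (rule abs_ge_self)
    also have "\<dots> \<le> \<bar>r\<bar> *\<^sub>R \<bar>x\<bar>" by (rule abs_scaleR_bl)
    also have "\<dots> \<le> \<bar>s - t\<bar> *\<^sub>R \<bar>x\<bar>" using that by (intro scaleR_right_mono) auto
    finally show ?thesis .
  qed
  have "rot z s - rot z t = (cos s - cos t) *\<^sub>R re_part z + (sin s - sin t) *\<^sub>R im_part z"
    by (simp add: rot_def algebra_simps)
  also have "\<dots> \<le> \<bar>s - t\<bar> *\<^sub>R \<bar>re_part z\<bar> + \<bar>s - t\<bar> *\<^sub>R \<bar>im_part z\<bar>"
    using le[OF c] le[OF d] by (rule add_mono)
  finally show ?thesis by (simp add: algebra_simps)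
qed

lemma modulus_exists:
  "\<exists>m. (\<forall>\<theta>. rot z \<theta> \<le> m) \<and> (\<forall>n. (\<forall>\<theta>. rot z \<theta> \<le> n) \<longrightarrow> m \<le> n)"
proof -
  define b where "b = \<bar>re_part z\<bar> + \<bar>im_part z\<bar>"
  define N where "N n = (\<lambda>k. real k / 2 ^ n) ` {..8 * 2 ^ n}" for n :: nat
  define s where "s n = Sup_fin (rot z ` N n)" for n
  have b0: "0 \<le> b" by (simp add: b_def)
  have fin: "finite (rot z ` N n)" "rot z ` N n \<noteq> {}" for n by (auto simp: N_def)
  have net: "rot z \<theta> \<le> s n + (1 / 2 ^ n) *\<^sub>R b" for \<theta> n
  proof -
    obtain t where t: "0 \<le> t" "t < 2 * pi" "cos \<theta> = cos t" "sin \<theta> = sin t"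
      using sincos_total_2pi[of "cos \<theta>" "sin \<theta>"] by auto
    define k where "k = nat \<lfloor>t * 2 ^ n\<rfloor>"
    have k: "real k \<le> t * 2 ^ n" "t * 2 ^ n < real k + 1"
      using t by (auto simp: k_def)
    have "t < 8" using t pi_less_4 by simp
    then have "t * 2 ^ n < 8 * 2 ^ n" by (intro mult_strict_right_mono) auto
    then have "real k < 8 * 2 ^ n" using k by linarith
    then have "real k < real (8 * 2 ^ n)" by simp
    then have "k \<le> 8 * 2 ^ n" by linarith
    then have kN: "real k / 2 ^ n \<in> N n" unfolding N_def by (intro imageI) simp
    have "real k / 2 ^ n \<le> t" "t < (real k + 1) / 2 ^ n"
      using k by (simp_all add: pos_divide_le_eq pos_less_divide_eq)
    then have "\<bar>t - real k / 2 ^ n\<bar> \<le> 1 / 2 ^ n"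
      by (simp add: abs_le_iff add_divide_distrib)
    then have "\<bar>t - real k / 2 ^ n\<bar> *\<^sub>R b \<le> (1 / 2 ^ n) *\<^sub>R b"
      using b0 by (intro scaleR_right_mono)
    moreover have "rot z t \<le> rot z (real k / 2 ^ n) + \<bar>t - real k / 2 ^ n\<bar> *\<^sub>R b"
      unfolding b_def by (rule rot_lipschitz)
    moreover have "rot z (real k / 2 ^ n) \<le> s n"
      unfolding s_def using fin kN by (intro Sup_fin.coboundedI) auto
    moreover have "rot z \<theta> = rot z t" using t by (simp add: rot_def)
    ultimately show ?thesis by (metis add_mono order_trans)
  qed
  have s_le: "s n \<le> m" if "\<And>\<theta>. rot z \<theta> \<le> m" for n m
    unfolding s_def using fin that by (intro Sup_fin.boundedI) auto
  have s_near: "s m \<le> s n + (1 / 2 ^ n) *\<^sub>R b" for m n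
    by (rule s_le) (rule net)
  have s_dist: "norm (s m - s n) \<le> (1 / 2 ^ N') * norm b" if "m \<ge> N'" "n \<ge> N'" for m n N'
  proof -
    have mono: "(1 / 2 ^ i) *\<^sub>R b \<le> (1 / 2 ^ N') *\<^sub>R b" if "i \<ge> N'" for i :: nat
      using that b0 by (intro scaleR_right_mono divide_left_mono power_increasing) auto
    have "s m - s n \<le> (1 / 2 ^ N') *\<^sub>R b" "- (s m - s n) \<le> (1 / 2 ^ N') *\<^sub>R b"
      using order_trans[OF s_near[of m n] add_left_mono[OF mono[OF that(2)]]]
            order_trans[OF s_near[of n m] add_left_mono[OF mono[OF that(1)]]]
      by (simp_all add: algebra_simps)
    then have "\<bar>s m - s n\<bar> \<le> (1 / 2 ^ N') *\<^sub>R b" by (rule abs_leI)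
    from norm_mono_nonneg[OF _ this] show ?thesis by (simp add: norm_abs_bl)
  qed
  have pow0: "(\<lambda>n. (1 / 2 ^ n) * c) \<longlonglongrightarrow> (0::real)" for c :: real
    using tendsto_mult_left_zero[OF LIMSEQ_realpow_zero[of "1/2"], of c]
    by (simp add: power_one_over)
  have "Cauchy s"
  proof (rule CauchyI)
    fix e :: real assume "0 < e"
    then obtain N' where "(1 / 2 ^ N') * norm b < e"
      using order_tendstoD(2)[OF pow0[of "norm b"]] by (auto simp: eventually_sequentially)
    then show "\<exists>M. \<forall>m\<ge>M. \<forall>n\<ge>M. norm (s m - s n) < e"
      using s_dist by (meson le_less_trans)
  qed
  then obtain m where m: "s \<longlonglongrightarrow> m"
    using Cauchy_convergent_iff convergent_def by blast
  have p0: "(\<lambda>n. (1 / 2 ^ n) *\<^sub>R b) \<longlonglongrightarrow> 0"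
    using tendsto_scaleR[OF pow0[of 1] tendsto_const[of b]] by simp
  have "rot z \<theta> \<le> m" for \<theta>
    using le_limit_bl[OF tendsto_const tendsto_add[OF m p0] net] by simp
  moreover have "m \<le> n" if "\<forall>\<theta>. rot z \<theta> \<le> n" for n
    using le_limit_bl[OF m tendsto_const s_le] that by blast
  ultimately show ?thesis by blast
qed

lemma modulus_props:
  shows rot_le_modulus: "rot z \<theta> \<le> modulus z"
    and modulus_least: "(\<And>\<theta>. rot z \<theta> \<le> n) \<Longrightarrow> modulus z \<le> n"
proof -
  have "\<exists>!m. (\<forall>\<theta>. rot z \<theta> \<le> m) \<and> (\<forall>n. (\<forall>\<theta>. rot z \<theta> \<le> n) \<longrightarrow> m \<le> n)"
    using modulus_exists[of z] by (metis order_antisym)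
  from theI'[OF this, folded modulus_def]
  show "rot z \<theta> \<le> modulus z" "(\<And>\<theta>. rot z \<theta> \<le> n) \<Longrightarrow> modulus z \<le> n" by auto
qed

lemma abs_re_le_modulus: "\<bar>re_part z\<bar> \<le> modulus z"
  and abs_im_le_modulus: "\<bar>im_part z\<bar> \<le> modulus z"
  using rot_le_modulus[of z 0] rot_le_modulus[of z pi]
    rot_le_modulus[of z "pi/2"] rot_le_modulus[of z "- (pi/2)"]
  by (auto intro!: abs_leI simp: rot_def)

lemma modulus_nonneg: "0 \<le> modulus z"
  using abs_re_le_modulus[of z] by (meson abs_ge_zero order_trans)

lemma modulus_le_abs: "modulus z \<le> \<bar>re_part z\<bar> + \<bar>im_part z\<bar>"
proof (rule modulus_least)
  fix \<theta>
  have le: "r *\<^sub>R x \<le> \<bar>x\<bar>" if "\<bar>r\<bar> \<le> 1" for r and x :: 'a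
  proof -
    have "r *\<^sub>R x \<le> \<bar>r *\<^sub>R x\<bar>" by (rule abs_ge_self)
    also have "\<dots> \<le> \<bar>r\<bar> *\<^sub>R \<bar>x\<bar>" by (rule abs_scaleR_bl)
    also have "\<dots> \<le> 1 *\<^sub>R \<bar>x\<bar>" using that by (intro scaleR_right_mono) auto
    finally show ?thesis by simp
  qed
  show "rot z \<theta> \<le> \<bar>re_part z\<bar> + \<bar>im_part z\<bar>"
    unfolding rot_def by (intro add_mono le) auto
qed

instantiation complexification :: (banach_lattice) real_normed_vector
begin

definition "0 = Complexification 0 0"

definition "z + w = Complexification (re_part z + re_part w) (im_part z + im_part w)"

definition "- z = Complexification (- re_part z) (- im_part z)"

definition "z - w = Complexification (re_part z - re_part w) (im_part z - im_part w)"

definition scaleR_complexification_def: "r *\<^sub>R z = Complexification (r *\<^sub>R re_part z) (r *\<^sub>R im_part z)"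

definition norm_complexification_def: "norm z = norm (modulus z)"

definition sgn_complexification_def: "sgn (z :: 'a complexification) = inverse (norm z) *\<^sub>R z"

definition dist_complexification_def: "dist (z :: 'a complexification) w = norm (z - w)"

definition uniformity_complexification_def [code del]:
  "(uniformity :: ('a complexification \<times> 'a complexification) filter) =
    (INF e\<in>{0 <..}. principal {(x, y). dist x y < e})"

definition open_complexification_def [code del]:
  "open (U :: 'a complexification set) \<longleftrightarrow>
    (\<forall>x\<in>U. eventually (\<lambda>(x', y). x' = x \<longrightarrow> y \<in> U) uniformity)"

lemmas complexification_ops = zero_complexification_def plus_complexification_def
  uminus_complexification_def minus_complexification_def scaleR_complexification_def

instance
proof
  fix x y z :: "'a complexification" and a b :: real
  show "a *\<^sub>R (x + y) = a *\<^sub>R x + a *\<^sub>R y" "(a + b) *\<^sub>R x = a *\<^sub>R x + b *\<^sub>R x"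
    "a *\<^sub>R b *\<^sub>R x = (a * b) *\<^sub>R x" "1 *\<^sub>R x = x"
    "x + y + z = x + (y + z)" "x + y = y + x" "0 + x = x" "- x + x = 0" "x - y = x + - y"
    by (simp_all add: complexification_ops algebra_simps)
  show "dist x y = norm (x - y)" by (rule dist_complexification_def)
  show "sgn x = inverse (norm x) *\<^sub>R x" by (rule sgn_complexification_def)
  show "(norm x = 0) = (x = 0)"
  proof
    assume "norm x = 0"
    then have "modulus x = 0" by (simp add: norm_complexification_def)
    then have "\<bar>re_part x\<bar> \<le> 0" "\<bar>im_part x\<bar> \<le> 0"
      using abs_re_le_modulus[of x] abs_im_le_modulus[of x] by auto
    then show "x = 0" by (cases x) (simp add: complexification_ops)
  next
    assume "x = 0"
    then have "modulus x \<le> 0"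
      by (intro modulus_least) (simp add: rot_def complexification_ops)
    then show "norm x = 0"
      using modulus_nonneg[of x] by (simp add: norm_complexification_def)
  qed
  show "norm (x + y) \<le> norm x + norm y"
  proof -
    have "modulus (x + y) \<le> modulus x + modulus y"
    proof (rule modulus_least)
      fix \<theta>
      have "rot (x + y) \<theta> = rot x \<theta> + rot y \<theta>"
        by (simp add: rot_def complexification_ops algebra_simps)
      then show "rot (x + y) \<theta> \<le> modulus x + modulus y"
        by (simp add: add_mono rot_le_modulus)
    qed
    then have "norm (x + y) \<le> norm (modulus x + modulus y)"
      unfolding norm_complexification_def by (intro norm_mono_nonneg modulus_nonneg)
    also have "\<dots> \<le> norm x + norm y"
      unfolding norm_complexification_def by (rule norm_triangle_ineq)
    finally show ?thesis .
  qed
  have le: "norm (c *\<^sub>R w) \<le> \<bar>c\<bar> * norm w" for c and w :: "'a complexification"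
  proof -
    have "modulus (c *\<^sub>R w) \<le> \<bar>c\<bar> *\<^sub>R modulus w"
    proof (rule modulus_least)
      fix \<theta>
      have "rot (c *\<^sub>R w) \<theta> = \<bar>c\<bar> *\<^sub>R rot w (if 0 \<le> c then \<theta> else \<theta> + pi)"
        by (simp add: rot_def complexification_ops algebra_simps)
      then show "rot (c *\<^sub>R w) \<theta> \<le> \<bar>c\<bar> *\<^sub>R modulus w"
        by (metis abs_ge_zero rot_le_modulus scaleR_left_mono)
    qed
    from norm_mono_nonneg[OF modulus_nonneg this] show ?thesis
      by (simp add: norm_complexification_def)
  qed
  show "norm (a *\<^sub>R x) = \<bar>a\<bar> * norm x"
  proof (cases "a = 0")
    case True
    have "modulus (0 *\<^sub>R x) \<le> 0"
      by (intro modulus_least) (simp add: rot_def complexification_ops)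
    then show ?thesis
      using True modulus_nonneg[of "0 *\<^sub>R x"] by (simp add: norm_complexification_def)
  next
    case False
    then have "inverse a *\<^sub>R a *\<^sub>R x = x"
      by (simp add: complexification_ops)
    then have "norm x \<le> \<bar>inverse a\<bar> * norm (a *\<^sub>R x)"
      using le[of "inverse a" "a *\<^sub>R x"] by simp
    then have "\<bar>a\<bar> * norm x \<le> norm (a *\<^sub>R x)"
      using False by (simp add: field_simps)
    then show ?thesis using le[of a x] by simp
  qed
qed (rule uniformity_complexification_def open_complexification_def)+

end

instance complexification :: (banach_lattice) banach
proof
  fix X :: "nat \<Rightarrow> 'a complexification" assume X: "Cauchy X"
  have comp: "norm (re_part z) \<le> norm z" "norm (im_part z) \<le> norm z"
    for z :: "'a complexification"
    using norm_mono_nonneg[OF _ abs_re_le_modulus[of z]] norm_mono_nonneg[OF _ abs_im_le_modulus[of z]]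
    by (simp_all add: norm_complexification_def norm_abs_bl)
  have diff: "re_part (z - w) = re_part z - re_part w" "im_part (z - w) = im_part z - im_part w"
    for z w :: "'a complexification" by (simp_all add: complexification_ops)
  have nd: "dist z w = norm (z - w)" for z w :: "'a complexification"
    by (rule dist_complexification_def)
  have "Cauchy (\<lambda>n. re_part (X n))" "Cauchy (\<lambda>n. im_part (X n))"
    using X comp unfolding Cauchy_def nd dist_norm diff[symmetric] by (meson le_less_trans)+
  then obtain a b where ab: "(\<lambda>n. re_part (X n)) \<longlonglongrightarrow> a" "(\<lambda>n. im_part (X n)) \<longlonglongrightarrow> b"
    using Cauchy_convergent_iff convergent_def by metis
  have bound: "norm (z - Complexification a b) \<le> norm (re_part z - a) + norm (im_part z - b)" for z
  proof -
    have "norm (z - Complexification a b) \<le> norm (\<bar>re_part z - a\<bar> + \<bar>im_part z - b\<bar>)"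
      using modulus_le_abs[of "z - Complexification a b"]
      unfolding norm_complexification_def by (intro norm_mono_nonneg modulus_nonneg) (simp add: diff)
    also have "\<dots> \<le> norm (re_part z - a) + norm (im_part z - b)"
      by (rule order_trans[OF norm_triangle_ineq]) (simp add: norm_abs_bl)
    finally show ?thesis .
  qed
  have lim: "(\<lambda>n. norm (re_part (X n) - a) + norm (im_part (X n) - b)) \<longlonglongrightarrow> 0"
    using tendsto_add[OF tendsto_norm[OF tendsto_diff[OF ab(1) tendsto_const[of a]]]
        tendsto_norm[OF tendsto_diff[OF ab(2) tendsto_const[of b]]]] by simp
  have "(\<lambda>n. X n - Complexification a b) \<longlonglongrightarrow> 0"
    by (rule Lim_null_comparison[OF _ lim]) (simp add: bound)
  then have "X \<longlonglongrightarrow> Complexification a b" by (rule LIM_zero_cancel)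
  then show "convergent X" by (rule convergentI)
qed

definition scaleC :: "complex \<Rightarrow> 'a::banach_lattice complexification \<Rightarrow> 'a complexification" where
  "scaleC c z = Complexification (Re c *\<^sub>R re_part z - Im c *\<^sub>R im_part z)
                                 (Re c *\<^sub>R im_part z + Im c *\<^sub>R re_part z)"

definition of_re :: "'a::banach_lattice \<Rightarrow> 'a complexification" where
  "of_re x = Complexification x 0"

definition bounded_clinear ::
  "('a::banach_lattice complexification \<Rightarrow> 'b::banach_lattice complexification) \<Rightarrow> bool" where
  "bounded_clinear T \<longleftrightarrow> bounded_linear T \<and> (\<forall>c z. T (scaleC c z) = scaleC c (T z))"

definition order_interval :: "'a::banach_lattice \<Rightarrow> 'a complexification set" where
  "order_interval u = {z. modulus z \<le> u}"

definition order_bounded ::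
  "('a::banach_lattice complexification \<Rightarrow> 'b::banach_lattice complexification) \<Rightarrow> bool" where
  "order_bounded T \<longleftrightarrow> (\<forall>u\<ge>0. \<exists>v\<ge>0. T ` order_interval u \<subseteq> order_interval v)"

definition AM_compact ::
  "('a::banach_lattice complexification \<Rightarrow> 'b::banach_lattice complexification) \<Rightarrow> bool" where
  "AM_compact T \<longleftrightarrow> order_bounded T \<and> (\<forall>u\<ge>0. compact (closure (T ` order_interval u)))"


section \<open>Nonstandard universes\<close>

text \<open>
  The type \<open>'u\<close> plays the role of a stage \<open>V\<^sub>n(X)\<close> of the superstructure over a set of individuals,
  large enough to contain the reals, the spaces under consideration and their subsets; \<open>'s\<close>
  is its nonstandard extension \<open>*V\<^sub>n(X)\<close>. Finitary relations on \<open>V\<^sub>n(X)\<close> are objects of some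
  later stage, so they are the constants of the formal language, and a quantifier ranging
  over \<open>'u\<close> is a quantifier bounded by \<open>V\<^sub>n(X)\<close>. An \<open>n\<close>-ary relation is a predicate
  on lists, of which only the lists of length \<open>n\<close> matter.
\<close>

datatype 'u formula =
    Eq nat nat
  | Rel "'u list \<Rightarrow> bool" "nat list"
  | Neg "'u formula"
  | Conj "'u formula" "'u formula"
  | Exi nat "'u formula"

primrec sat :: "(('u list \<Rightarrow> bool) \<Rightarrow> 's list \<Rightarrow> bool) \<Rightarrow> (nat \<Rightarrow> 's) \<Rightarrow> 'u formula \<Rightarrow> bool" where
  "sat I v (Eq i j) \<longleftrightarrow> v i = v j"
| "sat I v (Rel R is) \<longleftrightarrow> I R (map v is)"
| "sat I v (Neg \<phi>) \<longleftrightarrow> \<not> sat I v \<phi>"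
| "sat I v (Conj \<phi> \<psi>) \<longleftrightarrow> sat I v \<phi> \<and> sat I v \<psi>"
| "sat I v (Exi i \<phi>) \<longleftrightarrow> (\<exists>x. sat I (v(i := x)) \<phi>)"

text \<open>
  Distinct spaces may share individuals: the embeddings of \<open>E\<close>, \<open>F\<close> and of the reals
  need not have disjoint ranges.
  \<open>elem\<close> is the membership relation of the standard universe, \<open>num\<close> embeds the reals in it,
  \<open>star\<close> maps a standard object \<open>a\<close> to \<open>*a\<close>, and \<open>ext\<close> maps a relation \<open>R\<close> to \<open>*R\<close>.
\<close>

record ('u, 's) universe =
  elem :: "'u \<Rightarrow> 'u \<Rightarrow> bool"
  num :: "real \<Rightarrow> 'u"
  star :: "'u \<Rightarrow> 's"
  ext :: "('u list \<Rightarrow> bool) \<Rightarrow> 's list \<Rightarrow> bool"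

definition transfer_principle :: "('u, 's) universe \<Rightarrow> bool" where
  "transfer_principle U \<longleftrightarrow> (\<forall>\<phi> v. sat (\<lambda>R. R) v \<phi> \<longleftrightarrow> sat (ext U) (\<lambda>i. star U (v i)) \<phi>)"

definition star_set :: "('u, 's) universe \<Rightarrow> 'u set \<Rightarrow> 's set" where
  "star_set U A = {x. ext U (\<lambda>l. l ! 0 \<in> A) [x]}"

definition star_rel :: "('u, 's) universe \<Rightarrow> ('u \<Rightarrow> 'u \<Rightarrow> bool) \<Rightarrow> 's \<Rightarrow> 's \<Rightarrow> bool" where
  "star_rel U R x y \<longleftrightarrow> ext U (\<lambda>l. R (l ! 0) (l ! 1)) [x, y]"

definition star_fun :: "('u, 's) universe \<Rightarrow> ('u \<Rightarrow> 'u) \<Rightarrow> 's \<Rightarrow> 's" where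
  "star_fun U g x = (THE y. ext U (\<lambda>l. l ! 1 = g (l ! 0)) [x, y])"

definition star_fun2 :: "('u, 's) universe \<Rightarrow> ('u \<Rightarrow> 'u \<Rightarrow> 'u) \<Rightarrow> 's \<Rightarrow> 's \<Rightarrow> 's" where
  "star_fun2 U g x y = (THE z. ext U (\<lambda>l. l ! 2 = g (l ! 0) (l ! 1)) [x, y, z])"

definition internal :: "('u, 's) universe \<Rightarrow> 's set \<Rightarrow> bool" where
  "internal U A \<longleftrightarrow> (\<exists>p. A = {x. star_rel U (elem U) x p})"

definition saturated :: "('u, 's) universe \<Rightarrow> bool" where
  "saturated U \<longleftrightarrow> (\<forall>s A. (\<forall>i. elem U i s \<longrightarrow> internal U (A i)) \<longrightarrow>
     (\<forall>J. finite J \<longrightarrow> J \<subseteq> {i. elem U i s} \<longrightarrow> (\<Inter>i\<in>J. A i) \<noteq> {}) \<longrightarrow>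
     (\<Inter>i\<in>{i. elem U i s}. A i) \<noteq> {})"

text \<open>
  No further closure properties of the superstructure are imposed beyond the presence of
  (the copy of) the type \<open>'x\<close> and of all its subsets.
\<close>

definition embedded :: "('u, 's) universe \<Rightarrow> ('x \<Rightarrow> 'u) \<Rightarrow> bool" where
  "embedded U e \<longleftrightarrow> inj e \<and> (\<forall>A. \<exists>s. \<forall>x. elem U x s \<longleftrightarrow> x \<in> e ` A)"

definition nonstandard_universe :: "('u, 's) universe \<Rightarrow> bool" where
  "nonstandard_universe U \<longleftrightarrow> embedded U (num U) \<and> transfer_principle U \<and> saturated U"

definition star_less :: "('u, 's) universe \<Rightarrow> 's \<Rightarrow> 's \<Rightarrow> bool" where
  "star_less U = star_rel U (\<lambda>a b. \<exists>x y. a = num U x \<and> b = num U y \<and> x < y)"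

definition star_real :: "('u, 's) universe \<Rightarrow> real \<Rightarrow> 's" where
  "star_real U r = star U (num U r)"

definition standard_part :: "('u, 's) universe \<Rightarrow> 's \<Rightarrow> real" where
  "standard_part U x = (THE r. \<forall>\<epsilon>>0. star_less U (star_real U (r - \<epsilon>)) x \<and>
                                    star_less U x (star_real U (r + \<epsilon>)))"


section \<open>The nonstandard hull of a Banach lattice\<close>

text \<open>
  In the following \<open>e\<close> is an embedding of the Banach lattice \<open>E\<close> into the standard universe;
  \<open>*E\<close> is \<open>star_set U (range e)\<close>.
\<close>

definition star_minus ::
  "('u, 's) universe \<Rightarrow> ('a::banach_lattice complexification \<Rightarrow> 'u) \<Rightarrow> 's \<Rightarrow> 's \<Rightarrow> 's" where
  "star_minus U e = star_fun2 U (\<lambda>a b. e (inv e a - inv e b))"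

definition star_norm ::
  "('u, 's) universe \<Rightarrow> ('a::banach_lattice complexification \<Rightarrow> 'u) \<Rightarrow> 's \<Rightarrow> 's" where
  "star_norm U e = star_fun U (\<lambda>a. num U (norm (inv e a)))"

definition star_modulus ::
  "('u, 's) universe \<Rightarrow> ('a::banach_lattice complexification \<Rightarrow> 'u) \<Rightarrow> 's \<Rightarrow> 's" where
  "star_modulus U e = star_fun U (\<lambda>a. e (of_re (modulus (inv e a))))"

definition star_op ::
  "('u, 's) universe \<Rightarrow> ('a::banach_lattice complexification \<Rightarrow> 'u) \<Rightarrow>
   ('b::banach_lattice complexification \<Rightarrow> 'u) \<Rightarrow>
   ('a complexification \<Rightarrow> 'b complexification) \<Rightarrow> 's \<Rightarrow> 's" where
  "star_op U e f T = star_fun U (\<lambda>a. f (T (inv e a)))"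

definition fin ::
  "('u, 's) universe \<Rightarrow> ('a::banach_lattice complexification \<Rightarrow> 'u) \<Rightarrow> 's set" where
  "fin U e = {x \<in> star_set U (range e). \<exists>r. star_less U (star_norm U e x) (star_real U r)}"

definition monad0 ::
  "('u, 's) universe \<Rightarrow> ('a::banach_lattice complexification \<Rightarrow> 'u) \<Rightarrow> 's set" where
  "monad0 U e = {x \<in> star_set U (range e). \<forall>\<epsilon>>0. star_less U (star_norm U e x) (star_real U \<epsilon>)}"

definition near ::
  "('u, 's) universe \<Rightarrow> ('a::banach_lattice complexification \<Rightarrow> 'u) \<Rightarrow> ('s \<times> 's) set" where
  "near U e = {(x, y). x \<in> fin U e \<and> y \<in> fin U e \<and> star_minus U e x y \<in> monad0 U e}"

definition nonstd_hull ::
  "('u, 's) universe \<Rightarrow> ('a::banach_lattice complexification \<Rightarrow> 'u) \<Rightarrow> 's set set" where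
  "nonstd_hull U e = fin U e // near U e"

definition hat ::
  "('u, 's) universe \<Rightarrow> ('a::banach_lattice complexification \<Rightarrow> 'u) \<Rightarrow> 's \<Rightarrow> 's set" where
  "hat U e x = near U e `` {x}"

definition hull_of ::
  "('u, 's) universe \<Rightarrow> ('a::banach_lattice complexification \<Rightarrow> 'u) \<Rightarrow> 'a complexification \<Rightarrow> 's set"
  where "hull_of U e z = hat U e (star U (e z))"

text \<open>Operations on quotients are defined as unions over representatives, which all give the same class.\<close>

definition hull_minus ::
  "('u, 's) universe \<Rightarrow> ('a::banach_lattice complexification \<Rightarrow> 'u) \<Rightarrow> 's set \<Rightarrow> 's set \<Rightarrow> 's set" where
  "hull_minus U e \<xi> \<eta> = (\<Union>x\<in>\<xi>. \<Union>y\<in>\<eta>. hat U e (star_minus U e x y))"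

definition hull_modulus ::
  "('u, 's) universe \<Rightarrow> ('a::banach_lattice complexification \<Rightarrow> 'u) \<Rightarrow> 's set \<Rightarrow> 's set" where
  "hull_modulus U e \<xi> = (\<Union>x\<in>\<xi>. hat U e (star_modulus U e x))"

definition hull_norm ::
  "('u, 's) universe \<Rightarrow> ('a::banach_lattice complexification \<Rightarrow> 'u) \<Rightarrow> 's set \<Rightarrow> real" where
  "hull_norm U e \<xi> = the_elem ((\<lambda>x. standard_part U (star_norm U e x)) ` \<xi>)"

definition hull_op ::
  "('u, 's) universe \<Rightarrow> ('a::banach_lattice complexification \<Rightarrow> 'u) \<Rightarrow>
   ('b::banach_lattice complexification \<Rightarrow> 'u) \<Rightarrow>
   ('a complexification \<Rightarrow> 'b complexification) \<Rightarrow> 's set \<Rightarrow> 's set" where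
  "hull_op U e f T \<xi> = (\<Union>x\<in>\<xi>. hat U f (star_op U e f T x))"

text \<open>\<open>\<xi> \<le> \<eta>\<close> means that \<open>\<eta> - \<xi>\<close> lies in the positive cone \<open>{\<zeta>. \<bar>\<zeta>\<bar> = \<zeta>}\<close>.\<close>

definition hull_le ::
  "('u, 's) universe \<Rightarrow> ('a::banach_lattice complexification \<Rightarrow> 'u) \<Rightarrow> 's set \<Rightarrow> 's set \<Rightarrow> bool" where
  "hull_le U e \<xi> \<eta> \<longleftrightarrow> hull_modulus U e (hull_minus U e \<eta> \<xi>) = hull_minus U e \<eta> \<xi>"

definition hull_ideal ::
  "('u, 's) universe \<Rightarrow> ('a::banach_lattice complexification \<Rightarrow> 'u) \<Rightarrow> 's set set" where
  "hull_ideal U e = {\<xi> \<in> nonstd_hull U e. \<exists>u\<ge>0. hull_le U e (hull_modulus U e \<xi>) (hull_of U e (of_re u))}"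

definition closed_hull_ideal ::
  "('u, 's) universe \<Rightarrow> ('a::banach_lattice complexification \<Rightarrow> 'u) \<Rightarrow> 's set set" where
  "closed_hull_ideal U e =
     {\<xi> \<in> nonstd_hull U e. \<forall>\<epsilon>>0. \<exists>\<eta>\<in>hull_ideal U e. hull_norm U e (hull_minus U e \<xi> \<eta>) < \<epsilon>}"

definition cong_mod ::
  "('u, 's) universe \<Rightarrow> ('a::banach_lattice complexification \<Rightarrow> 'u) \<Rightarrow> 's set set \<Rightarrow>
   ('s set \<times> 's set) set" where
  "cong_mod U e M = {(\<xi>, \<eta>). \<xi> \<in> nonstd_hull U e \<and> \<eta> \<in> nonstd_hull U e \<and> hull_minus U e \<xi> \<eta> \<in> M}"

definition tilde_space ::
  "('u, 's) universe \<Rightarrow> ('a::banach_lattice complexification \<Rightarrow> 'u) \<Rightarrow> 's set set set" where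
  "tilde_space U e = nonstd_hull U e // cong_mod U e (range (hull_of U e))"

definition check_space ::
  "('u, 's) universe \<Rightarrow> ('a::banach_lattice complexification \<Rightarrow> 'u) \<Rightarrow> 's set set set" where
  "check_space U e = nonstd_hull U e // cong_mod U e (closed_hull_ideal U e)"

definition canonical_epi ::
  "('u, 's) universe \<Rightarrow> ('a::banach_lattice complexification \<Rightarrow> 'u) \<Rightarrow> 's set set \<Rightarrow> 's set set" where
  "canonical_epi U e X = (\<Union>\<xi>\<in>X. cong_mod U e (closed_hull_ideal U e) `` {\<xi>})"

definition tilde_op ::
  "('u, 's) universe \<Rightarrow> ('a::banach_lattice complexification \<Rightarrow> 'u) \<Rightarrow>
   ('b::banach_lattice complexification \<Rightarrow> 'u) \<Rightarrow>
   ('a complexification \<Rightarrow> 'b complexification) \<Rightarrow> 's set set \<Rightarrow> 's set set" where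
  "tilde_op U e f T X = (\<Union>\<xi>\<in>X. cong_mod U f (range (hull_of U f)) `` {hull_op U e f T \<xi>})"

end

theory Submission
  imports Defs
begin

text \<open>
  For a finite tuple \<open>xs\<close> of nonstandard objects, the relations \<open>P\<close> with \<open>*P(xs)\<close> form an
  ultrafilter on tuples of standard objects (the type of \<open>xs\<close>), and the objects \<open>*g(xs)\<close> obey
  the theorem of Los. A point of \<open>*E\<close> thus becomes an \<open>E\<close>-valued function along an ultrafilter: it is
  finite if the function is eventually bounded, infinitesimal if it tends to \<open>0\<close>, nearstandard
  if it converges, and its class lies in \<open>i\<^sub>E\<close> iff for each \<open>\<epsilon> > 0\<close> it is eventually within
  \<open>\<epsilon>\<close> of some standard interval \<open>[-u,u]\<close>. If \<open>T\<close> is AM-compact, the image of such a function is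
  eventually within \<open>\<epsilon>\<close> of a finite set for each \<open>\<epsilon>\<close>, hence converges by completeness. Conversely,
  saturation gives, for an interval \<open>[-u,u]\<close> with image not totally bounded, a point of
  \<open>*[-u,u]\<close> whose image stays away from every standard point. Factoring through the quotient by \<open>i\<^sub>E\<close>
  is the same as vanishing on \<open>i\<^sub>E\<close> modulo \<open>F\<close>.
\<close>

section \<open>Types of nonstandard tuples\<close>

lemma sat_finite_support:
  fixes I :: "('u list \<Rightarrow> bool) \<Rightarrow> 's list \<Rightarrow> bool"
  shows "\<exists>N. \<forall>v w. (\<forall>i<N. v i = w i) \<longrightarrow> sat I v \<phi> = sat I w \<phi>"
proof (induction \<phi>)
  case (Eq i j)
  show ?case by (rule exI[of _ "Suc (max i j)"]) simp
next
  case (Rel R js)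
  have eq: "map v js = map w js" if "\<forall>i<Suc (Max (set js)). v i = w i" for v w :: "nat \<Rightarrow> 's"
    using that by (simp add: less_Suc_eq_le)
  show ?case
    by (intro exI[of _ "Suc (Max (set js))"] allI impI) (simp only: sat.simps eq)
next
  case (Conj \<phi> \<psi>)
  then obtain M N where
    "\<forall>v w. (\<forall>i<M. v i = w i) \<longrightarrow> sat I v \<phi> = sat I w \<phi>"
    "\<forall>v w. (\<forall>i<N. v i = w i) \<longrightarrow> sat I v \<psi> = sat I w \<psi>" by blast
  then have "\<forall>v w. (\<forall>i<max M N. v i = w i) \<longrightarrow> sat I v (Conj \<phi> \<psi>) = sat I w (Conj \<phi> \<psi>)"
    by (metis less_max_iff_disj sat.simps(4))
  then show ?case by blast
next
  case (Exi i \<phi>)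
  then obtain N where N: "\<And>v w. (\<forall>j<N. v j = w j) \<Longrightarrow> sat I v \<phi> = sat I w \<phi>" by blast
  have "sat I v (Exi i \<phi>) = sat I w (Exi i \<phi>)" if "\<forall>j<N. v j = w j" for v w
  proof -
    have "sat I (v(i := x)) \<phi> = sat I (w(i := x)) \<phi>" for x
      using that by (intro N) simp
    then show ?thesis by simp
  qed
  then show ?case by blast
qed simp

text \<open>A formula depends on finitely many variables, so quantifying universally over all
  indices below a large \<open>n\<close> yields in effect a sentence, to which transfer
  applies.\<close>

primrec all_below :: "nat \<Rightarrow> 'u formula \<Rightarrow> 'u formula" where
  "all_below 0 \<phi> = \<phi>"
| "all_below (Suc n) \<phi> = all_below n (Neg (Exi n (Neg \<phi>)))"

lemma sat_all_below:
  fixes v :: "nat \<Rightarrow> 's"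
  shows "sat I v (all_below n \<phi>) \<longleftrightarrow> (\<forall>w. (\<forall>i\<ge>n. w i = v i) \<longrightarrow> sat I w \<phi>)"
proof (induction n arbitrary: \<phi>)
  case 0
  have "(\<forall>i\<ge>0. w i = v i) \<longleftrightarrow> w = v" for w :: "nat \<Rightarrow> 's" by auto
  then show ?case by simp
next
  case (Suc n)
  have "(\<forall>w. (\<forall>i\<ge>n. w i = v i) \<longrightarrow> (\<forall>x. sat I (w(n := x)) \<phi>)) \<longleftrightarrow>
      (\<forall>w. (\<forall>i\<ge>Suc n. w i = v i) \<longrightarrow> sat I w \<phi>)" (is "?L \<longleftrightarrow> ?R")
  proof
    assume L: ?L
    show ?R
    proof (intro allI impI)
      fix w assume "\<forall>i\<ge>Suc n. w i = v i"
      \<comment> \<open>Resetting \<open>w\<close> at \<open>n\<close> to the value of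
        \<open>v\<close> meets the hypothesis of \<open>L\<close>, whose quantifier over
        \<open>x\<close> then restores \<open>w n\<close>.\<close>
      then have "\<forall>i\<ge>n. (w(n := v n)) i = v i" by (simp add: Suc_le_eq)
      with L have "sat I (w(n := v n, n := w n)) \<phi>" by blast
      then show "sat I w \<phi>" by simp
    qed
  qed auto
  then show ?case by (simp add: Suc.IH)
qed

locale nonstandard =
  fixes U :: "('u, 's) universe"
  assumes nonstandard_universe: "nonstandard_universe U"
begin

lemma transfer: "sat (\<lambda>R. R) v \<phi> \<longleftrightarrow> sat (ext U) (\<lambda>i. star U (v i)) \<phi>"
  using nonstandard_universe by (simp add: nonstandard_universe_def transfer_principle_def)

text \<open>The transfer principle speaks only of assignments by standard objects. Validity is
  therefore packed into a universal closure, transferred at one standard assignment and instantiated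
  at \<open>v\<close> afterwards.\<close>

lemma transfer_valid:
  assumes "\<And>w. sat (\<lambda>R. R) w \<phi>"
  shows "sat (ext U) v \<phi>"
proof -
  obtain N where N: "\<And>v w. (\<forall>i<N. v i = w i) \<Longrightarrow> sat (ext U) v \<phi> = sat (ext U) w \<phi>"
    using sat_finite_support by blast
  have "sat (\<lambda>R. R) (\<lambda>_. undefined) (all_below N \<phi>)"
    using assms by (simp add: sat_all_below)
  then have "sat (ext U) (\<lambda>_. star U undefined) (all_below N \<phi>)"
    by (simp add: transfer)
  \<comment> \<open>The closure leaves the values from \<open>N\<close> on fixed, so the instance
    carries the transferred default there; the choice of \<open>N\<close> makes its difference from
    \<open>v\<close> invisible to the formula.\<close>
  then have "sat (ext U) (\<lambda>i. if i < N then v i else star U undefined) \<phi>"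
    by (simp add: sat_all_below)
  then show ?thesis using N[of v "\<lambda>i. if i < N then v i else star U undefined"] by simp
qed

lemma transfer_iff:
  assumes "\<And>w. sat (\<lambda>R. R) w \<phi> \<longleftrightarrow> sat (\<lambda>R. R) w \<psi>"
  shows "sat (ext U) v \<phi> \<longleftrightarrow> sat (ext U) v \<psi>"
  using transfer_valid[of "Conj (Neg (Conj \<phi> (Neg \<psi>))) (Neg (Conj \<psi> (Neg \<phi>)))" v] assms
  by auto

text \<open>The tuple enters as the assignment \<open>nth xs\<close>, and a relation is applied to
  it as the atomic formula on the variables \<open>[0..<length xs]\<close>. The next lemmas transfer
  the logical laws in this form.\<close>

lemma ext_True: "ext U (\<lambda>_. True) xs"
  using transfer_valid[of "Rel (\<lambda>_. True) [0..<length xs]" "nth xs"] by (simp add: map_nth)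

lemma ext_conj: "ext U (\<lambda>l. P l \<and> Q l) xs \<longleftrightarrow> ext U P xs \<and> ext U Q xs"
  using transfer_iff[of "Rel (\<lambda>l. P l \<and> Q l) [0..<length xs]"
      "Conj (Rel P [0..<length xs]) (Rel Q [0..<length xs])" "nth xs"]
  by (simp add: map_nth)

lemma ext_neg: "ext U (\<lambda>l. \<not> P l) xs \<longleftrightarrow> \<not> ext U P xs"
  using transfer_iff[of "Rel (\<lambda>l. \<not> P l) [0..<length xs]"
      "Neg (Rel P [0..<length xs])" "nth xs"]
  by (simp add: map_nth)

lemma ext_ex: "ext U (\<lambda>l. \<exists>y. P (l @ [y])) xs \<longleftrightarrow> (\<exists>y. ext U P (xs @ [y]))"
proof -
  \<comment> \<open>The bound variable is the first index outside the tuple, so updating it leaves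
    the entries of the tuple unchanged.\<close>
  have upd: "map (w(n := y)) [0..<n] = map w [0..<n]" for w :: "nat \<Rightarrow> 'c" and n y
    by (intro map_cong) auto
  show ?thesis
    using transfer_iff[of "Rel (\<lambda>l. \<exists>y. P (l @ [y])) [0..<length xs]"
        "Exi (length xs) (Rel P [0..<Suc (length xs)])" "nth xs"]
    by (simp add: map_nth upd)
qed

lemma ext_eq:
  assumes "i < length xs" "j < length xs"
  shows "ext U (\<lambda>l. l ! i = l ! j) xs \<longleftrightarrow> xs ! i = xs ! j"
  using transfer_iff[of "Rel (\<lambda>l. l ! i = l ! j) [0..<length xs]" "Eq i j" "nth xs"] assms
  by (simp add: map_nth)

text \<open>Holds because \<open>Rel P js\<close> is itself an atomic formula. Coordinates can thus
  be dropped, repeated or permuted, which moves facts between tuples of different lengths.\<close>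

lemma ext_reindex:
  assumes "\<forall>i\<in>set js. i < length xs"
  shows "ext U P (map (nth xs) js) \<longleftrightarrow> ext U (\<lambda>l. P (map (nth l) js)) xs"
proof -
  have eq: "map (nth (map w [0..<length xs])) js = map w js" for w :: "nat \<Rightarrow> 'u"
    using assms by (intro map_cong) auto
  show ?thesis
    using transfer_iff[of "Rel P js" "Rel (\<lambda>l. P (map (nth l) js)) [0..<length xs]" "nth xs"]
    unfolding sat.simps eq by (simp only: map_nth simp_thms)
qed

lemma ext_star: "ext U P (map (star U) as) \<longleftrightarrow> P as"
proof -
  have "map (\<lambda>i. star U (as ! i)) [0..<length as] = map (star U) as"
    by (rule nth_equalityI) auto
  then show ?thesis using transfer[of "nth as" "Rel P [0..<length as]"] by (simp add: map_nth)
qed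

section \<open>Ultrafilters of tuples and the theorem of Los\<close>

definition type_filter :: "'s list \<Rightarrow> 'u list filter" where
  "type_filter xs = Abs_filter (\<lambda>P. ext U P xs)"

lemma eventually_type: "eventually P (type_filter xs) \<longleftrightarrow> ext U P xs"
  unfolding type_filter_def
proof (rule eventually_Abs_filter, rule is_filter.intro)
  show "ext U (\<lambda>_. True) xs" by (rule ext_True)
  show "ext U (\<lambda>l. P l \<and> Q l) xs" if "ext U P xs" "ext U Q xs" for P Q
    using that by (simp add: ext_conj)
  show "ext U Q xs" if "\<forall>l. P l \<longrightarrow> Q l" "ext U P xs" for P Q
  proof -
    have "(\<lambda>l. P l \<and> Q l) = P" using that(1) by auto
    then show ?thesis using ext_conj[of P Q xs] that(2) by simp
  qed
qed

text \<open>This is the ultrafilter property, inherited from the commutation of \<open>ext\<close>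
  with negation.\<close>

lemma type_filter_not: "eventually (\<lambda>l. \<not> P l) (type_filter xs) \<longleftrightarrow> \<not> eventually P (type_filter xs)"
  by (simp add: eventually_type ext_neg)

lemma type_filter_neq_bot: "type_filter xs \<noteq> bot"
  using type_filter_not[of "\<lambda>_. False" xs] by (auto simp: eventually_False[symmetric])

text \<open>\<open>val xs g\<close> is the internal element \<open>*g(xs)\<close>.\<close>

definition val :: "'s list \<Rightarrow> ('u list \<Rightarrow> 'u) \<Rightarrow> 's" where
  "val xs g = (THE y. ext U (\<lambda>l. last l = g (butlast l)) (xs @ [y]))"

lemma map_nth_prefix: "map (nth (xs @ ys)) [0..<length xs] = xs"
  by (rule nth_equalityI) (auto simp: nth_append)

text \<open>Carries the graph of \<open>g\<close> from \<open>xs\<close> followed by one value to a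
  longer tuple, where several values can be compared under one filter.\<close>

lemma graph_reindex:
  assumes "k < length ys"
  shows "ext U (\<lambda>l. last l = g (butlast l)) (xs @ [ys ! k]) \<longleftrightarrow>
    (\<forall>\<^sub>F l in type_filter (xs @ ys). l ! (length xs + k) = g (map (nth l) [0..<length xs]))"
proof -
  have "xs @ [ys ! k] = map (nth (xs @ ys)) ([0..<length xs] @ [length xs + k])"
    by (simp add: map_nth_prefix)
  then show ?thesis
    using ext_reindex[of "[0..<length xs] @ [length xs + k]" "xs @ ys" "\<lambda>l. last l = g (butlast l)"] assms
    by (simp add: eventually_type)
qed

lemma ex1_val: "\<exists>!y. ext U (\<lambda>l. last l = g (butlast l)) (xs @ [y])"
proof -
  \<comment> \<open>Totality of \<open>g\<close> is true of all standard tuples;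
    \<open>ext_ex\<close> turns it into a nonstandard value.\<close>
  have "ext U (\<lambda>l. \<exists>y. last (l @ [y]) = g (butlast (l @ [y]))) xs"
    using ext_True[of xs] by simp
  then obtain y where y: "ext U (\<lambda>l. last l = g (butlast l)) (xs @ [y])"
    unfolding ext_ex[where P = "\<lambda>l. last l = g (butlast l)"] ..
  have "z = y" if z: "ext U (\<lambda>l. last l = g (butlast l)) (xs @ [z])" for z
  proof -
    let ?n = "length xs"
    \<comment> \<open>Both candidates sit in one tuple, so the two graph events meet in one filter
      and force equal coordinates.\<close>
    let ?zs = "xs @ [y, z]"
    have "\<forall>\<^sub>F l in type_filter ?zs. l ! ?n = g (map (nth l) [0..<?n])"
      using graph_reindex[of 0 "[y, z]" g xs] y by simp
    moreover have "\<forall>\<^sub>F l in type_filter ?zs. l ! Suc ?n = g (map (nth l) [0..<?n])"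
      using graph_reindex[of 1 "[y, z]" g xs] z by simp
    ultimately have "ext U (\<lambda>l. l ! Suc ?n = l ! ?n) ?zs"
      unfolding eventually_type[symmetric] by eventually_elim simp
    then show ?thesis using ext_eq[of "Suc ?n" ?zs ?n] by (simp add: nth_append)
  qed
  with y show ?thesis by blast
qed

lemma ext_val: "ext U (\<lambda>l. last l = g (butlast l)) (xs @ [val xs g])"
  unfolding val_def by (rule theI'[OF ex1_val])

lemma val_eqI: "ext U (\<lambda>l. last l = g (butlast l)) (xs @ [y]) \<Longrightarrow> val xs g = y"
  using ex1_val ext_val by blast

text \<open>All the values are adjoined to \<open>xs\<close>. In the filter of the longer tuple the
  new coordinates are eventually the functions \<open>gs\<close> of the old ones, and a condition on
  the old ones alone descends to \<open>xs\<close> by reindexing.\<close>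

lemma Los: "ext U P (map (val xs) gs) \<longleftrightarrow> (\<forall>\<^sub>F l in type_filter xs. P (map (\<lambda>g. g l) gs))"
proof -
  let ?n = "length xs" and ?k = "length gs"
  let ?zs = "xs @ map (val xs) gs"
  have graph: "\<forall>\<^sub>F l in type_filter ?zs. l ! (?n + i) = (gs ! i) (map (nth l) [0..<?n])"
    if "i < ?k" for i
    using graph_reindex[of i "map (val xs) gs" "gs ! i" xs] ext_val[of "gs ! i" xs] that by simp
  have "\<forall>\<^sub>F l in type_filter ?zs. \<forall>i\<in>{..<?k}. l ! (?n + i) = (gs ! i) (map (nth l) [0..<?n])"
    using graph by (intro eventually_ball_finite) auto
  then have all: "\<forall>\<^sub>F l in type_filter ?zs.
      map (nth l) [?n..<?n + ?k] = map (\<lambda>g. g (map (nth l) [0..<?n])) gs"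
    by eventually_elim (intro nth_equalityI; simp)
  have "map (val xs) gs = map (nth ?zs) [?n..<?n + ?k]"
    by (intro nth_equalityI) (auto simp: nth_append)
  then have "ext U P (map (val xs) gs) \<longleftrightarrow> (\<forall>\<^sub>F l in type_filter ?zs. P (map (nth l) [?n..<?n + ?k]))"
    using ext_reindex[of "[?n..<?n + ?k]" ?zs P] by (simp add: eventually_type)
  also have "\<dots> \<longleftrightarrow> (\<forall>\<^sub>F l in type_filter ?zs. P (map (\<lambda>g. g (map (nth l) [0..<?n])) gs))"
    by (rule eventually_subst) (use all in eventually_elim, simp)
  also have "\<dots> \<longleftrightarrow> (\<forall>\<^sub>F l in type_filter xs. P (map (\<lambda>g. g l) gs))"
  proof -
    show ?thesis
      using ext_reindex[of "[0..<?n]" ?zs "\<lambda>l. P (map (\<lambda>g. g l) gs)"]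
      by (simp add: eventually_type map_nth_prefix)
  qed
  finally show ?thesis .
qed

text \<open>Every entry of a tuple is thus the value of a coordinate function, so statements about
  \<open>val\<close> reach every nonstandard object.\<close>

lemma val_proj: "i < length xs \<Longrightarrow> val xs (\<lambda>l. l ! i) = xs ! i"
proof (rule val_eqI)
  assume i: "i < length xs"
  have eq: "xs @ [xs ! i] = map (nth xs) ([0..<length xs] @ [i])" by (simp add: map_nth)
  have "ext U (\<lambda>l. last (map (nth l) ([0..<length xs] @ [i])) =
      butlast (map (nth l) ([0..<length xs] @ [i])) ! i) xs"
    using ext_True[of xs] i by simp
  then show "ext U (\<lambda>l. last l = butlast l ! i) (xs @ [xs ! i])"
    unfolding eq using i by (subst ext_reindex) auto
qed

lemma val_const: "val xs (\<lambda>_. a) = star U a"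
proof (rule val_eqI)
  let ?zs = "xs @ [star U a]"
  have "ext U (\<lambda>l. l ! 0 = a) (map (nth ?zs) [length xs])"
    using ext_star[of "\<lambda>l. l ! 0 = a" "[a]"] by simp
  then have "\<forall>\<^sub>F l in type_filter ?zs. l ! length xs = a"
    using ext_reindex[of "[length xs]" ?zs "\<lambda>l. l ! 0 = a"] by (simp add: eventually_type)
  then show "ext U (\<lambda>l. last l = a) ?zs"
    using graph_reindex[of 0 "[star U a]" "\<lambda>_. a" xs] by simp
qed

lemma val_eq_iff: "val xs g = val xs h \<longleftrightarrow> (\<forall>\<^sub>F l in type_filter xs. g l = h l)"
  using Los[of "\<lambda>l. l ! 0 = l ! 1" xs "[g, h]"] ext_eq[of 0 "[val xs g, val xs h]" 1] by simp

lemma star_set_val: "val xs g \<in> star_set U A \<longleftrightarrow> (\<forall>\<^sub>F l in type_filter xs. g l \<in> A)"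
  using Los[of "\<lambda>l. l ! 0 \<in> A" xs "[g]"] by (simp add: star_set_def)

lemma star_rel_val:
  "star_rel U R (val xs g) (val xs h) \<longleftrightarrow> (\<forall>\<^sub>F l in type_filter xs. R (g l) (h l))"
  using Los[of "\<lambda>l. R (l ! 0) (l ! 1)" xs "[g, h]"] by (simp add: star_rel_def)

lemma star_fun_val: "star_fun U G (val xs g) = val xs (\<lambda>l. G (g l))"
  unfolding star_fun_def
proof (rule the_equality)
  let ?R = "\<lambda>l. l ! 1 = G (l ! 0)"
  show *: "ext U ?R [val xs g, val xs (\<lambda>l. G (g l))]"
    using Los[of ?R xs "[g, \<lambda>l. G (g l)]"] by simp
  fix y assume y: "ext U ?R [val xs g, y]"
  \<comment> \<open>As for \<open>val\<close>, the competitor \<open>y\<close> is compared inside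
    one tuple that also contains the argument and the intended value.\<close>
  let ?zs = "[val xs g, val xs (\<lambda>l. G (g l)), y]"
  have "ext U (\<lambda>l. l ! 1 = G (l ! 0)) ?zs"
    using * ext_reindex[of "[0, 1]" ?zs ?R] by simp
  moreover have "ext U (\<lambda>l. l ! 2 = G (l ! 0)) ?zs"
    using y ext_reindex[of "[0, 2]" ?zs ?R] by simp
  ultimately have "ext U (\<lambda>l. l ! 2 = l ! 1) ?zs"
    unfolding eventually_type[symmetric] by eventually_elim simp
  then show "y = val xs (\<lambda>l. G (g l))" using ext_eq[of 2 ?zs 1] by simp
qed

lemma star_fun2_val: "star_fun2 U G (val xs g) (val xs h) = val xs (\<lambda>l. G (g l) (h l))"
  unfolding star_fun2_def
proof (rule the_equality)
  let ?R = "\<lambda>l. l ! 2 = G (l ! 0) (l ! 1)"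
  show *: "ext U ?R [val xs g, val xs h, val xs (\<lambda>l. G (g l) (h l))]"
    using Los[of ?R xs "[g, h, \<lambda>l. G (g l) (h l)]"] by simp
  fix y assume y: "ext U ?R [val xs g, val xs h, y]"
  let ?zs = "[val xs g, val xs h, val xs (\<lambda>l. G (g l) (h l)), y]"
  have "ext U (\<lambda>l. l ! 2 = G (l ! 0) (l ! 1)) ?zs"
    using * ext_reindex[of "[0, 1, 2]" ?zs ?R] by simp
  moreover have "ext U (\<lambda>l. l ! 3 = G (l ! 0) (l ! 1)) ?zs"
    using y ext_reindex[of "[0, 1, 3]" ?zs ?R] by simp
  ultimately have "ext U (\<lambda>l. l ! 3 = l ! 2) ?zs"
    unfolding eventually_type[symmetric] by eventually_elim simp
  then show "y = val xs (\<lambda>l. G (g l) (h l))" using ext_eq[of 3 ?zs 2] by simp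
qed

end

section \<open>Nonstandard hulls\<close>

lemma modulus_triangle: "modulus (z + w) \<le> modulus z + modulus w"
proof (rule modulus_least)
  fix \<theta>
  have "rot (z + w) \<theta> = rot z \<theta> + rot w \<theta>"
    by (simp add: rot_def complexification_ops algebra_simps)
  then show "rot (z + w) \<theta> \<le> modulus z + modulus w" by (simp add: add_mono rot_le_modulus)
qed

lemma modulus_minus_le: "modulus (- z) \<le> modulus z"
proof (rule modulus_least)
  fix \<theta>
  have "rot (- z) \<theta> = rot z (\<theta> + pi)" by (simp add: rot_def complexification_ops)
  then show "rot (- z) \<theta> \<le> modulus z" by (simp add: rot_le_modulus)
qed

lemma modulus_minus: "modulus (- z) = modulus z"
  using modulus_minus_le[of z] modulus_minus_le[of "- z"] by simp

lemma modulus_triangle_diff: "modulus (z - w) \<le> modulus z + modulus w"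
  using modulus_triangle[of z "- w"] by (simp add: modulus_minus)

lemma modulus_diff_abs: "\<bar>modulus z - modulus w\<bar> \<le> modulus (z - w)"
  using modulus_triangle[of "z - w" w] modulus_triangle[of "w - z" z] modulus_minus[of "z - w"]
  by (intro abs_leI) (simp_all add: algebra_simps)

lemma of_re_diff: "of_re (x - y) = of_re x - of_re y"
  by (simp add: of_re_def minus_complexification_def)

lemma modulus_of_re: "modulus (of_re x) = \<bar>x\<bar>"
  using modulus_le_abs[of "of_re x"] abs_re_le_modulus[of "of_re x"] by (simp add: of_re_def)

lemma norm_of_re: "norm (of_re x) = norm x"
  by (simp add: norm_complexification_def modulus_of_re norm_abs_bl)

lemma norm_of_re_modulus: "norm (of_re (modulus z)) = norm z"
  by (simp add: norm_of_re norm_complexification_def[of z])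

lemma norm_modulus_diff_le: "norm (modulus z - modulus w) \<le> norm (z - w)"
  using norm_mono_nonneg[OF abs_ge_zero modulus_diff_abs[of z w]]
  by (simp add: norm_complexification_def norm_abs_bl)

lemma norm_le_of_order_interval: "z \<in> order_interval u \<Longrightarrow> norm z \<le> norm u"
  by (simp add: norm_complexification_def order_interval_def norm_mono_nonneg modulus_nonneg)

lemma truncation:
  fixes a u h :: "'a::banach_lattice"
  assumes "\<bar>a\<bar> \<le> u + h" "0 \<le> u" "0 \<le> h"
  shows "\<exists>b. \<bar>b\<bar> \<le> u \<and> \<bar>a - b\<bar> \<le> h"
proof (intro exI conjI abs_leI)
  \<comment> \<open>Clip \<open>a\<close> to \<open>[-u,u]\<close>; by hypothesis \<open>a\<close>
    overshoots either end by at most \<open>h\<close>.\<close>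
  let ?b = "sup (inf a u) (- u)"
  have a: "a \<le> u + h" "- a \<le> u + h" using assms(1) by (simp_all add: abs_le_iff)
  show "?b \<le> u" using assms by (auto intro: le_infI2 order_trans[of "- u" 0])
  show "- ?b \<le> u" by (metis minus_le_iff sup_ge2)
  have "a - h \<le> inf a u" using a assms by (simp add: algebra_simps)
  then have "a - h \<le> ?b" by (rule le_supI1)
  then show "a - ?b \<le> h" by (simp only: diff_le_eq add.commute)
  have "- u \<le> a + h" using add_left_mono[OF a(2), of "a - u"] by (simp add: algebra_simps)
  then have "?b \<le> a + h" using assms by (intro sup_least le_infI1) simp_all
  then show "- (a - ?b) \<le> h" by (simp only: minus_diff_eq diff_le_eq add.commute)
qed

text \<open>Truncating real and imaginary parts separately avoids the Riesz decomposition property of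
  the complexification; the price, a factor 2, is harmless for the ideals below.\<close>

lemma complex_truncation:
  fixes z :: "'a::banach_lattice complexification"
  assumes "modulus z \<le> u + h" "0 \<le> u" "0 \<le> h"
  shows "\<exists>w\<in>order_interval (u + u). norm (z - w) \<le> 2 * norm h"
proof -
  have "\<bar>re_part z\<bar> \<le> u + h" "\<bar>im_part z\<bar> \<le> u + h"
    using assms abs_re_le_modulus abs_im_le_modulus order_trans by blast+
  then obtain a b where ab: "\<bar>a\<bar> \<le> u" "\<bar>re_part z - a\<bar> \<le> h" "\<bar>b\<bar> \<le> u" "\<bar>im_part z - b\<bar> \<le> h"
    using truncation assms by meson
  let ?w = "Complexification a b"
  have "modulus ?w \<le> u + u"
    using modulus_le_abs[of ?w] add_mono[OF ab(1,3)] by simp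
  moreover have "modulus (z - ?w) \<le> h + h"
    using modulus_le_abs[of "z - ?w"] add_mono[OF ab(2,4)] by (simp add: minus_complexification_def)
  then have "norm (z - ?w) \<le> norm (h + h)"
    unfolding norm_complexification_def by (intro norm_mono_nonneg modulus_nonneg)
  then have "norm (z - ?w) \<le> 2 * norm h" using norm_triangle_ineq[of h h] by simp
  ultimately show ?thesis by (auto simp: order_interval_def)
qed

text \<open>The open norm neighbourhood of \<open>[-u,u]\<close>. It serves to express membership in
  the closed ideal without reference to the order and norm of the hull.\<close>

definition thickened_interval :: "'a::banach_lattice \<Rightarrow> real \<Rightarrow> 'a complexification set" where
  "thickened_interval u \<epsilon> = {z. \<exists>w\<in>order_interval u. norm (z - w) < \<epsilon>}"

lemma thickened_interval_diff:
  assumes "z \<in> thickened_interval u \<delta>" "w \<in> thickened_interval v \<epsilon>"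
  shows "z - w \<in> thickened_interval (u + v) (\<delta> + \<epsilon>)"
proof -
  obtain z' w' where *: "modulus z' \<le> u" "norm (z - z') < \<delta>" "modulus w' \<le> v" "norm (w - w') < \<epsilon>"
    using assms by (auto simp: thickened_interval_def order_interval_def)
  have "modulus (z' - w') \<le> u + v"
    using modulus_triangle_diff[of z' w'] add_mono[OF *(1,3)] by simp
  moreover have "norm ((z - w) - (z' - w')) < \<delta> + \<epsilon>"
    using norm_triangle_ineq4[of "z - z'" "w - w'"] * by (simp add: algebra_simps)
  ultimately show ?thesis by (auto simp: thickened_interval_def order_interval_def)
qed

section \<open>Limits along the ultrafilters of tuples, and standard parts\<close>

context nonstandard
begin

text \<open>Compactness gives a cluster point of the image filter, and an ultrafilter converges to
  each of its cluster points.\<close>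

lemma ultrafilter_compact:
  assumes "compact K" "\<forall>\<^sub>F l in type_filter xs. g l \<in> K"
  shows "\<exists>k\<in>K. (g \<longlongrightarrow> k) (type_filter xs)"
proof -
  have "filtermap g (type_filter xs) \<noteq> bot"
    by (simp add: filtermap_bot_iff type_filter_neq_bot)
  moreover have "\<forall>\<^sub>F y in filtermap g (type_filter xs). y \<in> K"
    using assms by (simp add: eventually_filtermap)
  ultimately obtain k where k: "k \<in> K" "inf (nhds k) (filtermap g (type_filter xs)) \<noteq> bot"
    using assms(1) unfolding compact_filter by blast
  have "\<forall>\<^sub>F l in type_filter xs. g l \<in> S" if "open S" "k \<in> S" for S
  proof (rule ccontr)
    assume "\<not> (\<forall>\<^sub>F l in type_filter xs. g l \<in> S)"
    then have "\<forall>\<^sub>F y in filtermap g (type_filter xs). y \<notin> S"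
      by (simp add: eventually_filtermap type_filter_not)
    moreover have "\<forall>\<^sub>F y in nhds k. y \<in> S"
      using that by (simp add: eventually_nhds_in_open)
    ultimately have "\<forall>\<^sub>F y in inf (nhds k) (filtermap g (type_filter xs)). False"
      unfolding eventually_inf by blast
    then show False using k(2) by (simp add: eventually_False)
  qed
  then show ?thesis using k(1) by (auto simp: tendsto_def)
qed

lemma inj_num: "inj (num U)"
  using nonstandard_universe by (simp add: nonstandard_universe_def embedded_def)

lemma star_less_val:
  "star_less U (val xs (\<lambda>l. num U (r l))) (val xs (\<lambda>l. num U (s l))) \<longleftrightarrow>
    (\<forall>\<^sub>F l in type_filter xs. r l < s l)"
proof -
  have "(\<exists>x y. num U a = num U x \<and> num U b = num U y \<and> x < y) \<longleftrightarrow> a < b" for a b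
    using inj_num by (auto dest: injD)
  then show ?thesis by (simp add: star_less_def star_rel_val)
qed

lemma star_real_val: "star_real U r = val xs (\<lambda>_. num U r)"
  by (simp add: star_real_def val_const)

text \<open>The condition defining the standard part says that \<open>r\<close> converges to the
  candidate along the filter, so uniqueness of limits evaluates the definite description.\<close>

lemma standard_part_val:
  assumes "(r \<longlongrightarrow> L) (type_filter xs)"
  shows "standard_part U (val xs (\<lambda>l. num U (r l))) = L"
proof -
  have "(\<forall>\<epsilon>>0. star_less U (star_real U (s - \<epsilon>)) (val xs (\<lambda>l. num U (r l))) \<and>
      star_less U (val xs (\<lambda>l. num U (r l))) (star_real U (s + \<epsilon>))) \<longleftrightarrow>
      (r \<longlongrightarrow> s) (type_filter xs)" for s
  proof -
    have "(\<forall>\<^sub>F l in type_filter xs. s - \<epsilon> < r l) \<and> (\<forall>\<^sub>F l in type_filter xs. r l < s + \<epsilon>)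
        \<longleftrightarrow> (\<forall>\<^sub>F l in type_filter xs. dist (r l) s < \<epsilon>)" for \<epsilon>
      unfolding eventually_conj_iff[symmetric]
      by (intro eventually_cong refl always_eventually allI) (auto simp: dist_real_def abs_less_iff)
    then show ?thesis by (simp add: star_real_val[where xs = xs] star_less_val tendsto_iff)
  qed
  then show ?thesis
    unfolding standard_part_def using assms tendsto_unique[OF type_filter_neq_bot]
    by (intro the_equality) auto
qed

lemma bounded_convergent:
  fixes r :: "'u list \<Rightarrow> real"
  assumes "\<forall>\<^sub>F l in type_filter xs. \<bar>r l\<bar> < b"
  shows "\<exists>L. (r \<longlongrightarrow> L) (type_filter xs)"
proof -
  have "\<forall>\<^sub>F l in type_filter xs. r l \<in> {-b..b}"
    using assms by eventually_elim auto
  then show ?thesis using ultrafilter_compact[of "{-b..b}"] by blast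
qed

end

section \<open>Internal points as lattice-valued functions\<close>

locale embedded_lattice = nonstandard U for U :: "('u, 's) universe" +
  fixes e :: "'a::banach_lattice complexification \<Rightarrow> 'u"
  assumes embedded: "embedded U e"
begin

lemma inj: "inj e"
  using embedded by (simp add: embedded_def)

lemma inv_e [simp]: "inv e (e z) = z"
  using inj by simp

text \<open>The embedding is absorbed, so that representing functions take values in the lattice and
  the starred operations act pointwise.\<close>

definition pt :: "'s list \<Rightarrow> ('u list \<Rightarrow> 'a complexification) \<Rightarrow> 's" where
  "pt xs a = val xs (\<lambda>l. e (a l))"

lemma star_set_pt: "pt xs a \<in> star_set U (e ` A) \<longleftrightarrow> (\<forall>\<^sub>F l in type_filter xs. a l \<in> A)"
  by (simp add: pt_def star_set_val inj_image_mem_iff[OF inj])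

lemma star_set_range_pt: "pt xs a \<in> star_set U (range e)"
  by (simp add: star_set_pt)

lemma ex_pt:
  assumes "x \<in> star_set U (range e)" "x \<in> set xs"
  shows "\<exists>a. x = pt xs a"
proof -
  obtain i where i: "i < length xs" "x = xs ! i"
    using assms(2) by (auto simp: in_set_conv_nth)
  then have x: "x = val xs (\<lambda>l. l ! i)" using val_proj by simp
  with assms have "\<forall>\<^sub>F l in type_filter xs. l ! i \<in> range e" by (simp add: star_set_val)
  \<comment> \<open>Outside \<open>range e\<close> the function \<open>inv e\<close> returns
    arbitrary values, but the filter contains the event that the coordinate lies in
    \<open>range e\<close>.\<close>
  then have "val xs (\<lambda>l. l ! i) = pt xs (\<lambda>l. inv e (l ! i))"
    unfolding pt_def val_eq_iff by eventually_elim (simp add: f_inv_into_f)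
  then show ?thesis unfolding x by blast
qed

text \<open>One common tuple puts all the points over the same ultrafilter, where their functions
  can be subtracted. Four points are what well-definedness of a binary operation takes: two
  arguments and another representative of each.\<close>

lemma obtain_pt4:
  assumes "x \<in> star_set U (range e)" "y \<in> star_set U (range e)"
    "z \<in> star_set U (range e)" "w \<in> star_set U (range e)"
  obtains xs a b c d where "x = pt xs a" "y = pt xs b" "z = pt xs c" "w = pt xs d"
proof -
  let ?xs = "[x, y, z, w]"
  have "\<exists>a. x = pt ?xs a" "\<exists>b. y = pt ?xs b" "\<exists>c. z = pt ?xs c" "\<exists>d. w = pt ?xs d"
    by (rule ex_pt; simp add: assms)+
  then show ?thesis using that by blast
qed

lemma star_pt: "star U (e z) = pt xs (\<lambda>_. z)"
  by (simp add: pt_def val_const)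

lemma star_minus_pt: "star_minus U e (pt xs a) (pt xs b) = pt xs (\<lambda>l. a l - b l)"
  by (simp add: star_minus_def pt_def star_fun2_val)

lemma star_norm_pt: "star_norm U e (pt xs a) = val xs (\<lambda>l. num U (norm (a l)))"
  by (simp add: star_norm_def pt_def star_fun_val)

lemma star_modulus_pt: "star_modulus U e (pt xs a) = pt xs (\<lambda>l. of_re (modulus (a l)))"
  by (simp add: star_modulus_def pt_def star_fun_val)

lemma star_norm_less_pt:
  "star_less U (star_norm U e (pt xs a)) (star_real U r) \<longleftrightarrow>
    (\<forall>\<^sub>F l in type_filter xs. norm (a l) < r)"
  by (simp add: star_norm_pt star_real_val[where xs = xs] star_less_val)

lemma fin_pt: "pt xs a \<in> fin U e \<longleftrightarrow> (\<exists>r. \<forall>\<^sub>F l in type_filter xs. norm (a l) < r)"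
  by (simp add: fin_def star_set_range_pt star_norm_less_pt)

lemma fin_subset: "fin U e \<subseteq> star_set U (range e)"
  by (auto simp: fin_def)

lemma obtain_fin3:
  assumes "x \<in> fin U e" "y \<in> fin U e" "z \<in> fin U e"
  obtains xs a b c where "x = pt xs a" "y = pt xs b" "z = pt xs c"
proof (rule obtain_pt4[of x y z z])
  show "x \<in> star_set U (range e)" "y \<in> star_set U (range e)"
    "z \<in> star_set U (range e)" "z \<in> star_set U (range e)"
    using assms fin_subset by auto
qed (rule that)

lemma near_pt:
  "(pt xs a, pt xs b) \<in> near U e \<longleftrightarrow> pt xs a \<in> fin U e \<and> pt xs b \<in> fin U e \<and>
    ((\<lambda>l. a l - b l) \<longlongrightarrow> 0) (type_filter xs)"
  by (simp add: near_def star_minus_pt monad0_def star_set_range_pt star_norm_less_pt tendsto_iff)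

lemma fin_diff:
  assumes "pt xs a \<in> fin U e" "pt xs b \<in> fin U e"
  shows "pt xs (\<lambda>l. a l - b l) \<in> fin U e"
proof -
  obtain r s where "\<forall>\<^sub>F l in type_filter xs. norm (a l) < r" "\<forall>\<^sub>F l in type_filter xs. norm (b l) < s"
    using assms by (auto simp: fin_pt)
  then have "\<forall>\<^sub>F l in type_filter xs. norm (a l - b l) < r + s"
    by eventually_elim (rule le_less_trans[OF norm_triangle_ineq4], simp)
  then show ?thesis by (auto simp: fin_pt)
qed

lemma fin_const: "pt xs (\<lambda>_. z) \<in> fin U e"
  unfolding fin_pt by (rule exI[of _ "norm z + 1"]) simp

lemma fin_modulus: "pt xs a \<in> fin U e \<Longrightarrow> pt xs (\<lambda>l. of_re (modulus (a l))) \<in> fin U e"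
  by (simp add: fin_pt norm_of_re_modulus)

section \<open>Operations and norm on the nonstandard hull\<close>

lemma equiv_near: "equiv (fin U e) (near U e)"
proof (rule equivI)
  show "near U e \<subseteq> fin U e \<times> fin U e" by (auto simp: near_def)
  show "refl_on (fin U e) (near U e)"
  proof (rule refl_onI)
    fix x assume x: "x \<in> fin U e"
    then obtain a where "x = pt [x] a" using ex_pt[of x "[x]"] fin_subset by auto
    with x show "(x, x) \<in> near U e" using near_pt[of "[x]" a a] by simp
  qed
  show "sym (near U e)"
  proof (rule symI)
    fix x y assume xy: "(x, y) \<in> near U e"
    then have "x \<in> star_set U (range e)" "y \<in> star_set U (range e)"
      using fin_subset by (auto simp: near_def)
    then obtain zs a b where *: "x = pt zs a" "y = pt zs b"
      by (metis obtain_pt4)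
    show "(y, x) \<in> near U e"
      using xy tendsto_minus[of "\<lambda>l. a l - b l" 0] unfolding * near_pt by simp
  qed
  show "trans (near U e)"
  proof (rule transI)
    fix x y z assume xyz: "(x, y) \<in> near U e" "(y, z) \<in> near U e"
    then have "x \<in> star_set U (range e)" "y \<in> star_set U (range e)" "z \<in> star_set U (range e)"
      using fin_subset by (auto simp: near_def)
    then obtain zs a b c where *: "x = pt zs a" "y = pt zs b" "z = pt zs c"
      by (metis obtain_pt4)
    show "(x, z) \<in> near U e"
      using xyz tendsto_add[of "\<lambda>l. a l - b l" 0 _ "\<lambda>l. b l - c l" 0]
      unfolding * near_pt by simp
  qed
qed

lemma hat_in_hull: "x \<in> fin U e \<Longrightarrow> hat U e x \<in> nonstd_hull U e"
  by (simp add: hat_def nonstd_hull_def quotientI)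

lemma hat_eq_iff:
  assumes "x \<in> fin U e" "y \<in> fin U e"
  shows "hat U e x = hat U e y \<longleftrightarrow> (x, y) \<in> near U e"
  unfolding hat_def using eq_equiv_class_iff[OF equiv_near assms] .

lemma hat_pt_eq_iff:
  assumes "pt xs a \<in> fin U e" "pt xs b \<in> fin U e"
  shows "hat U e (pt xs a) = hat U e (pt xs b) \<longleftrightarrow> ((\<lambda>l. a l - b l) \<longlongrightarrow> 0) (type_filter xs)"
  by (simp add: hat_eq_iff assms near_pt)

lemma obtain_hat:
  assumes "\<xi> \<in> nonstd_hull U e"
  obtains x where "x \<in> fin U e" "\<xi> = hat U e x"
  using assms unfolding nonstd_hull_def hat_def by (rule quotientE)

lemma obtain_hat3:
  assumes "\<xi> \<in> nonstd_hull U e" "\<eta> \<in> nonstd_hull U e" "\<zeta> \<in> nonstd_hull U e"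
  obtains xs a b c where "pt xs a \<in> fin U e" "pt xs b \<in> fin U e" "pt xs c \<in> fin U e"
    "\<xi> = hat U e (pt xs a)" "\<eta> = hat U e (pt xs b)" "\<zeta> = hat U e (pt xs c)"
proof -
  obtain x y z where *: "x \<in> fin U e" "y \<in> fin U e" "z \<in> fin U e"
    "\<xi> = hat U e x" "\<eta> = hat U e y" "\<zeta> = hat U e z"
    using assms obtain_hat by metis
  moreover from this(1-3) obtain xs a b c where "x = pt xs a" "y = pt xs b" "z = pt xs c"
    by (metis obtain_fin3)
  ultimately show ?thesis using that by metis
qed

lemma hull_of_pt: "hull_of U e z = hat U e (pt xs (\<lambda>_. z))"
  by (simp add: hull_of_def star_pt[of z xs])

lemma hull_of_in_hull: "hull_of U e z \<in> nonstd_hull U e"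
  by (simp add: hull_of_pt[of _ "[]"] hat_in_hull fin_const)

text \<open>The union over representatives collapses to one class, since infinitesimal changes of
  both arguments change the difference by an infinitesimal.\<close>

lemma hull_minus_hat:
  assumes "pt xs a \<in> fin U e" "pt xs b \<in> fin U e"
  shows "hull_minus U e (hat U e (pt xs a)) (hat U e (pt xs b)) = hat U e (pt xs (\<lambda>l. a l - b l))"
proof -
  have "congruent2 (near U e) (near U e) (\<lambda>x y. hat U e (star_minus U e x y))"
    unfolding congruent2_def
  proof (clarify)
    fix x x' y y' assume n: "(x, x') \<in> near U e" "(y, y') \<in> near U e"
    have "x \<in> star_set U (range e)" "x' \<in> star_set U (range e)"
      "y \<in> star_set U (range e)" "y' \<in> star_set U (range e)"
      using n fin_subset by (auto simp: near_def)
    then obtain zs a a' b b' where *: "x = pt zs a" "x' = pt zs a'" "y = pt zs b" "y' = pt zs b'"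
      by (rule obtain_pt4)
    have "((\<lambda>l. (a l - a' l) - (b l - b' l)) \<longlongrightarrow> 0 - 0) (type_filter zs)"
      using n unfolding * near_pt by (intro tendsto_diff) auto
    then have "((\<lambda>l. (a l - b l) - (a' l - b' l)) \<longlongrightarrow> 0) (type_filter zs)"
      by (simp add: algebra_simps)
    then show "hat U e (star_minus U e x y) = hat U e (star_minus U e x' y')"
      using n unfolding * by (simp add: near_pt star_minus_pt hat_pt_eq_iff fin_diff)
  qed
  from UN_equiv_class2[OF equiv_near equiv_near this assms] show ?thesis
    by (simp add: hull_minus_def hat_def[of U e "pt xs a"] hat_def[of U e "pt xs b"] star_minus_pt)
qed

text \<open>The modulus is 1-Lipschitz for the norm, so infinitely close points have infinitely
  close moduli.\<close>

lemma hull_modulus_hat: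
  assumes "pt xs a \<in> fin U e"
  shows "hull_modulus U e (hat U e (pt xs a)) = hat U e (pt xs (\<lambda>l. of_re (modulus (a l))))"
proof -
  have "congruent (near U e) (\<lambda>x. hat U e (star_modulus U e x))"
    unfolding congruent_def
  proof (clarify)
    fix x y assume n: "(x, y) \<in> near U e"
    then have "x \<in> star_set U (range e)" "y \<in> star_set U (range e)"
      using fin_subset by (auto simp: near_def)
    then obtain zs a b where *: "x = pt zs a" "y = pt zs b"
      by (metis obtain_pt4)
    have "((\<lambda>l. norm (a l - b l)) \<longlongrightarrow> 0) (type_filter zs)"
      using n unfolding * by (simp add: near_pt tendsto_norm_zero)
    then have "((\<lambda>l. of_re (modulus (a l)) - of_re (modulus (b l))) \<longlongrightarrow> 0) (type_filter zs)"
      by (rule Lim_null_comparison[rotated])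
        (simp add: of_re_diff[symmetric] norm_of_re norm_modulus_diff_le)
    then show "hat U e (star_modulus U e x) = hat U e (star_modulus U e y)"
      using n unfolding * by (simp add: near_pt star_modulus_pt hat_pt_eq_iff fin_modulus)
  qed
  from UN_equiv_class[OF equiv_near this assms] show ?thesis
    by (simp add: hull_modulus_def hat_def[of U e "pt xs a"] star_modulus_pt)
qed

text \<open>The norm of a finite point is eventually bounded and so converges along the ultrafilter,
  with the standard part as limit. In this form, bounds on the hull norm and eventual bounds on the
  representing function follow from the order properties of limits.\<close>

lemma hull_norm_hat:
  assumes "pt xs a \<in> fin U e"
  shows "((\<lambda>l. norm (a l)) \<longlongrightarrow> hull_norm U e (hat U e (pt xs a))) (type_filter xs)"
proof -
  let ?st = "\<lambda>x. standard_part U (star_norm U e x)"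
  have st: "((\<lambda>l. norm (b l)) \<longlongrightarrow> ?st (pt ys b)) (type_filter ys)" if fin: "pt ys b \<in> fin U e" for ys b
  proof -
    obtain r where "\<forall>\<^sub>F l in type_filter ys. \<bar>norm (b l)\<bar> < r" using fin by (auto simp: fin_pt)
    from bounded_convergent[OF this]
    obtain L where L: "((\<lambda>l. norm (b l)) \<longlongrightarrow> L) (type_filter ys)" ..
    then show ?thesis using standard_part_val[OF L] by (simp add: star_norm_pt)
  qed
  have eq: "?st y = ?st x" if n: "(x, y) \<in> near U e" for x y
  proof -
    have fin: "x \<in> fin U e" "y \<in> fin U e" using n by (auto simp: near_def)
    then obtain zs a b where *: "x = pt zs a" "y = pt zs b"
      by (metis obtain_fin3)
    have ab: "((\<lambda>l. a l - b l) \<longlongrightarrow> 0) (type_filter zs)" using n unfolding * near_pt by simp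
    have "((\<lambda>l. norm (a l) - norm (b l)) \<longlongrightarrow> 0) (type_filter zs)"
      using tendsto_norm_zero[OF ab]
      by (rule Lim_null_comparison[rotated]) (simp add: norm_triangle_ineq3)
    moreover have "((\<lambda>l. norm (a l) - norm (b l)) \<longlongrightarrow> ?st x - ?st y) (type_filter zs)"
      using fin unfolding * by (intro tendsto_diff st)
    ultimately have "?st x - ?st y = 0" using tendsto_unique[OF type_filter_neq_bot] by blast
    then show ?thesis by simp
  qed
  \<comment> \<open>The \<open>the_elem\<close> in the definition of the hull norm asks for a
    singleton image, which \<open>eq\<close> provides.\<close>
  have "?st ` hat U e (pt xs a) = {?st (pt xs a)}"
  proof (intro equalityI image_subsetI subsetI)
    show "?st y \<in> {?st (pt xs a)}" if "y \<in> hat U e (pt xs a)" for y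
      using that eq unfolding hat_def by blast
    show "t \<in> ?st ` hat U e (pt xs a)" if "t \<in> {?st (pt xs a)}" for t
      using that equiv_class_self[OF equiv_near assms] unfolding hat_def by blast
  qed
  then show ?thesis using st[OF assms] by (simp add: hull_norm_def)
qed

section \<open>The ideal generated by E and its closure\<close>

lemma hull_ideal_pt:
  assumes "pt xs a \<in> fin U e"
  shows "hat U e (pt xs a) \<in> hull_ideal U e \<longleftrightarrow>
    (\<exists>u\<ge>0. ((\<lambda>l. \<bar>u - modulus (a l)\<bar> - (u - modulus (a l))) \<longlongrightarrow> 0) (type_filter xs))"
proof -
  have "hull_le U e (hull_modulus U e (hat U e (pt xs a))) (hull_of U e (of_re u)) \<longleftrightarrow>
      ((\<lambda>l. \<bar>u - modulus (a l)\<bar> - (u - modulus (a l))) \<longlongrightarrow> 0) (type_filter xs)" for u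
  proof -
    \<comment> \<open>\<open>\<bar>d\<bar> - d\<close> is twice the negative part of
      \<open>d\<close>; it tends to 0 iff the modulus of \<open>a\<close> exceeds \<open>u\<close>
      by an infinitesimal at most.\<close>
    define d where "d = (\<lambda>l. u - modulus (a l))"
    have fin: "pt xs (\<lambda>l. of_re (d l)) \<in> fin U e"
      using fin_diff[OF fin_const[of xs "of_re u"] fin_modulus[OF assms]]
      by (simp add: d_def of_re_diff)
    have "hull_minus U e (hull_of U e (of_re u)) (hull_modulus U e (hat U e (pt xs a))) =
        hat U e (pt xs (\<lambda>l. of_re (d l)))"
      using assms
      by (simp add: hull_modulus_hat hull_of_pt[of _ xs] hull_minus_hat fin_const fin_modulus
          d_def of_re_diff)
    then have "hull_le U e (hull_modulus U e (hat U e (pt xs a))) (hull_of U e (of_re u)) \<longleftrightarrow>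
      ((\<lambda>l. of_re (modulus (of_re (d l))) - of_re (d l)) \<longlongrightarrow> 0) (type_filter xs)"
      using fin by (simp add: hull_le_def hull_modulus_hat hat_pt_eq_iff fin_modulus)
    also have "\<dots> \<longleftrightarrow> ((\<lambda>l. norm (of_re (\<bar>d l\<bar> - d l))) \<longlongrightarrow> 0) (type_filter xs)"
      by (simp only: tendsto_norm_zero_iff of_re_diff modulus_of_re)
    also have "\<dots> \<longleftrightarrow> ((\<lambda>l. \<bar>d l\<bar> - d l) \<longlongrightarrow> 0) (type_filter xs)"
      by (simp only: norm_of_re tendsto_norm_zero_iff)
    finally show ?thesis by (simp add: d_def)
  qed
  then show ?thesis using assms by (simp add: hull_ideal_def hat_in_hull)
qed

text \<open>The defect \<open>h u\<close> bounds the excess of the modulus over \<open>u\<close> and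
  tends to 0. Cutting it off moves a point by at most \<open>2 * norm (h u l)\<close> into the
  interval of \<open>u + u\<close>, so one interval serves all \<epsilon>.\<close>

lemma hull_ideal_thickened:
  assumes "pt xs a \<in> fin U e" "hat U e (pt xs a) \<in> hull_ideal U e"
  shows "\<exists>u\<ge>0. \<forall>\<epsilon>>0. \<forall>\<^sub>F l in type_filter xs. a l \<in> thickened_interval u \<epsilon>"
proof -
  define h where "h = (\<lambda>u l. \<bar>u - modulus (a l)\<bar> - (u - modulus (a l)))"
  obtain u where u: "0 \<le> u" and lim: "(h u \<longlongrightarrow> 0) (type_filter xs)"
    using assms hull_ideal_pt by (auto simp: h_def)
  have "\<forall>\<^sub>F l in type_filter xs. a l \<in> thickened_interval (u + u) \<epsilon>" if "0 < \<epsilon>" for \<epsilon>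
  proof -
    have "\<forall>\<^sub>F l in type_filter xs. norm (h u l) < \<epsilon> / 2"
      using lim half_gt_zero[OF that] unfolding tendsto_iff dist_norm diff_zero by blast
    then show ?thesis
    proof eventually_elim
      case (elim l)
      have "0 \<le> h u l" by (simp add: h_def abs_ge_self)
      moreover have "modulus (a l) \<le> u + h u l"
        using abs_ge_zero[of "u - modulus (a l)"] by (simp add: h_def)
      ultimately obtain w where "w \<in> order_interval (u + u)" "norm (a l - w) \<le> 2 * norm (h u l)"
        using complex_truncation u by blast
      with elim show ?case by (force simp: thickened_interval_def)
    qed
  qed
  then show ?thesis using u by (intro exI[of _ "u + u"]) simp
qed

lemma order_interval_hull_ideal:
  assumes "pt xs a \<in> fin U e" "0 \<le> u" "\<forall>\<^sub>F l in type_filter xs. a l \<in> order_interval u"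
  shows "hat U e (pt xs a) \<in> hull_ideal U e"
proof -
  have "\<forall>\<^sub>F l in type_filter xs. \<bar>u - modulus (a l)\<bar> - (u - modulus (a l)) = 0"
    using assms(3) by eventually_elim (simp add: order_interval_def abs_of_nonneg)
  then have "((\<lambda>l. \<bar>u - modulus (a l)\<bar> - (u - modulus (a l))) \<longlongrightarrow> 0) (type_filter xs)"
    by (rule tendsto_eventually)
  then show ?thesis using assms hull_ideal_pt by blast
qed

text \<open>An approximating element of the ideal is itself close to a standard interval;
  conversely, nearby points of the interval represent an element of the ideal. Here, unlike in
  \<open>hull_ideal_thickened\<close>, \<open>u\<close> varies with \<epsilon>.\<close>

lemma closed_hull_ideal_iff:
  assumes "x \<in> fin U e"
  shows "hat U e x \<in> closed_hull_ideal U e \<longleftrightarrow>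
    (\<forall>\<epsilon>>0. \<exists>u\<ge>0. x \<in> star_set U (e ` thickened_interval u \<epsilon>))"
proof (intro iffI allI impI)
  fix \<epsilon> :: real assume I: "hat U e x \<in> closed_hull_ideal U e" and "0 < \<epsilon>"
  from I half_gt_zero[OF this(2)] obtain \<eta> where
    \<eta>: "\<eta> \<in> hull_ideal U e" "hull_norm U e (hull_minus U e (hat U e x) \<eta>) < \<epsilon> / 2"
    unfolding closed_hull_ideal_def by blast
  then have "\<eta> \<in> nonstd_hull U e" by (simp add: hull_ideal_def)
  then obtain y where y: "y \<in> fin U e" "\<eta> = hat U e y" by (rule obtain_hat)
  obtain xs a b where ab: "x = pt xs a" "y = pt xs b"
    using assms y(1) by (metis obtain_fin3)
  have fin: "pt xs a \<in> fin U e" "pt xs b \<in> fin U e" using assms y(1) by (simp_all add: ab)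
  obtain u where u: "0 \<le> u" "\<forall>\<^sub>F l in type_filter xs. b l \<in> thickened_interval u (\<epsilon> / 2)"
    using hull_ideal_thickened[OF fin(2)] \<eta>(1) y(2) half_gt_zero[OF \<open>0 < \<epsilon>\<close>] unfolding ab by blast
  have "hull_norm U e (hat U e (pt xs (\<lambda>l. a l - b l))) < \<epsilon> / 2"
    using \<eta>(2) fin by (simp add: y(2) ab hull_minus_hat)
  with hull_norm_hat[OF fin_diff[OF fin]]
  have "\<forall>\<^sub>F l in type_filter xs. norm (a l - b l) < \<epsilon> / 2" by (rule order_tendstoD)
  with u(2) have "\<forall>\<^sub>F l in type_filter xs. a l \<in> thickened_interval u \<epsilon>"
  proof eventually_elim
    case (elim l)
    then obtain w where w: "w \<in> order_interval u" "norm (b l - w) < \<epsilon> / 2"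
      by (auto simp: thickened_interval_def)
    have "norm (a l - w) < \<epsilon>"
      using norm_triangle_ineq[of "a l - b l" "b l - w"] elim(2) w(2) by simp
    with w(1) show ?case by (auto simp: thickened_interval_def)
  qed
  then show "\<exists>u\<ge>0. x \<in> star_set U (e ` thickened_interval u \<epsilon>)"
    using u(1) by (auto simp: ab star_set_pt)
next
  assume R: "\<forall>\<epsilon>>0. \<exists>u\<ge>0. x \<in> star_set U (e ` thickened_interval u \<epsilon>)"
  obtain xs a where a: "x = pt xs a"
    using assms by (metis obtain_fin3)
  have fin: "pt xs a \<in> fin U e" using assms by (simp add: a)
  have "\<exists>\<eta>\<in>hull_ideal U e. hull_norm U e (hull_minus U e (hat U e x) \<eta>) < \<epsilon>" if pos: "0 < \<epsilon>" for \<epsilon>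
  proof -
    obtain u where u: "0 \<le> u" "\<forall>\<^sub>F l in type_filter xs. a l \<in> thickened_interval u (\<epsilon> / 2)"
      using R half_gt_zero[OF pos] unfolding a star_set_pt by blast
    \<comment> \<open>Points of the interval are chosen list by list on the standard side, and any
      such function represents an internal point. Off the event \<open>u(2)\<close> the choice is
      arbitrary.\<close>
    define b where "b = (\<lambda>l. SOME w. w \<in> order_interval u \<and> norm (a l - w) < \<epsilon> / 2)"
    have b: "\<forall>\<^sub>F l in type_filter xs. b l \<in> order_interval u \<and> norm (a l - b l) < \<epsilon> / 2"
      using u(2)
    proof eventually_elim
      case (elim l)
      then have "\<exists>w. w \<in> order_interval u \<and> norm (a l - w) < \<epsilon> / 2"
        by (auto simp: thickened_interval_def)
      then show ?case unfolding b_def by (rule someI_ex)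
    qed
    then have "\<forall>\<^sub>F l in type_filter xs. norm (b l) < norm u + 1"
    proof eventually_elim
      case (elim l)
      then show ?case using norm_le_of_order_interval[of "b l" u] by simp
    qed
    then have fin_b: "pt xs b \<in> fin U e" by (auto simp: fin_pt)
    have "hat U e (pt xs b) \<in> hull_ideal U e"
      using b by (intro order_interval_hull_ideal[OF fin_b u(1)]) (auto elim: eventually_mono)
    \<comment> \<open>The limit keeps only the weak bound; halving \<epsilon> leaves room for the
      strict one.\<close>
    moreover have "hull_norm U e (hat U e (pt xs (\<lambda>l. a l - b l))) \<le> \<epsilon> / 2"
      using b by (intro tendsto_upperbound[OF hull_norm_hat[OF fin_diff[OF fin fin_b]]] type_filter_neq_bot)
        (auto elim: eventually_mono)
    then have "hull_norm U e (hull_minus U e (hat U e x) (hat U e (pt xs b))) < \<epsilon>"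
      using fin fin_b pos by (simp add: a hull_minus_hat)
    ultimately show ?thesis by blast
  qed
  then show "hat U e x \<in> closed_hull_ideal U e"
    using assms by (simp add: closed_hull_ideal_def hat_in_hull)
qed

section \<open>Congruences modulo E and modulo the closed ideal\<close>

lemma
  assumes "\<xi> \<in> nonstd_hull U e"
  shows hull_minus_self: "hull_minus U e \<xi> \<xi> = hull_of U e 0"
    and hull_minus_zero: "hull_minus U e \<xi> (hull_of U e 0) = \<xi>"
proof (atomize (full), rule obtain_hat3[OF assms assms assms])
  fix xs a assume "pt xs a \<in> fin U e" "\<xi> = hat U e (pt xs a)"
  then show "hull_minus U e \<xi> \<xi> = hull_of U e 0 \<and> hull_minus U e \<xi> (hull_of U e 0) = \<xi>"
    by (simp add: hull_of_pt[of _ xs] hull_minus_hat fin_const)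
qed

lemma hull_minus_cancel:
  assumes "\<xi> \<in> nonstd_hull U e" "\<eta> \<in> nonstd_hull U e" "\<zeta> \<in> nonstd_hull U e"
  shows "hull_minus U e (hull_minus U e \<xi> \<zeta>) (hull_minus U e \<eta> \<zeta>) = hull_minus U e \<xi> \<eta>"
proof (rule obtain_hat3[OF assms])
  fix xs a b c
  assume "pt xs a \<in> fin U e" "pt xs b \<in> fin U e" "pt xs c \<in> fin U e"
    "\<xi> = hat U e (pt xs a)" "\<eta> = hat U e (pt xs b)" "\<zeta> = hat U e (pt xs c)"
  then show ?thesis by (simp add: hull_minus_hat fin_diff)
qed

text \<open>Only differences are available on the hull. Symmetry comes from subtracting an element
  of \<open>M\<close> from 0, transitivity from \<open>hull_minus_cancel\<close>, which cancels the
  common middle term.\<close>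

lemma equiv_cong_mod:
  assumes M: "hull_of U e 0 \<in> M"
    and diff: "\<And>\<xi> \<eta>. \<xi> \<in> M \<Longrightarrow> \<eta> \<in> M \<Longrightarrow> hull_minus U e \<xi> \<eta> \<in> M"
  shows "equiv (nonstd_hull U e) (cong_mod U e M)"
proof (rule equivI)
  show "cong_mod U e M \<subseteq> nonstd_hull U e \<times> nonstd_hull U e" by (auto simp: cong_mod_def)
  show "refl_on (nonstd_hull U e) (cong_mod U e M)"
    using M by (auto simp: refl_on_def cong_mod_def hull_minus_self)
  show sym: "sym (cong_mod U e M)"
  proof (rule symI)
    fix \<xi> \<eta> assume "(\<xi>, \<eta>) \<in> cong_mod U e M"
    then have *: "\<xi> \<in> nonstd_hull U e" "\<eta> \<in> nonstd_hull U e" "hull_minus U e \<xi> \<eta> \<in> M"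
      by (auto simp: cong_mod_def)
    have "hull_minus U e (hull_of U e 0) (hull_minus U e \<xi> \<eta>) = hull_minus U e \<eta> \<xi>"
      using hull_minus_cancel[OF *(2,1,2)] hull_minus_self[OF *(2)] by simp
    then show "(\<eta>, \<xi>) \<in> cong_mod U e M" using * diff[OF M *(3)] by (simp add: cong_mod_def)
  qed
  show "trans (cong_mod U e M)"
  proof (rule transI)
    fix \<xi> \<eta> \<zeta> assume 1: "(\<xi>, \<eta>) \<in> cong_mod U e M" and "(\<eta>, \<zeta>) \<in> cong_mod U e M"
    then have 2: "(\<zeta>, \<eta>) \<in> cong_mod U e M" using sym by (auto dest: symD)
    from 1 2 show "(\<xi>, \<zeta>) \<in> cong_mod U e M"
      using diff[of "hull_minus U e \<xi> \<eta>" "hull_minus U e \<zeta> \<eta>"] hull_minus_cancel[of \<xi> \<zeta> \<eta>]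
      by (simp add: cong_mod_def)
  qed
qed

lemma hull_of_diff: "hull_minus U e (hull_of U e z) (hull_of U e w) = hull_of U e (z - w)"
  by (simp add: hull_of_pt[of _ "[]"] hull_minus_hat fin_const)

lemma equiv_tilde: "equiv (nonstd_hull U e) (cong_mod U e (range (hull_of U e)))"
  by (rule equiv_cong_mod) (auto simp: hull_of_diff)

text \<open>A point lies in the interval of its own modulus. The inclusion makes the canonical
  epimorphism well defined.\<close>

lemma hull_of_in_closed_hull_ideal: "hull_of U e z \<in> closed_hull_ideal U e"
proof -
  have "z \<in> thickened_interval (modulus z) \<epsilon>" if "0 < \<epsilon>" for \<epsilon>
    using that by (auto simp: thickened_interval_def order_interval_def intro!: bexI[of _ z])
  then show ?thesis
    unfolding hull_of_pt[of _ "[]"] closed_hull_ideal_iff[OF fin_const] star_set_pt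
    by (intro allI impI exI[of _ "modulus z"]) (simp add: modulus_nonneg)
qed

lemma closed_hull_ideal_subset: "closed_hull_ideal U e \<subseteq> nonstd_hull U e"
  by (auto simp: closed_hull_ideal_def)

lemma closed_hull_ideal_diff:
  assumes "\<xi> \<in> closed_hull_ideal U e" "\<eta> \<in> closed_hull_ideal U e"
  shows "hull_minus U e \<xi> \<eta> \<in> closed_hull_ideal U e"
proof -
  have "\<xi> \<in> nonstd_hull U e" "\<eta> \<in> nonstd_hull U e" using assms closed_hull_ideal_subset by auto
  then obtain xs a b where
    fin: "pt xs a \<in> fin U e" "pt xs b \<in> fin U e" and
    eq: "\<xi> = hat U e (pt xs a)" "\<eta> = hat U e (pt xs b)"
    using obtain_hat3[of \<xi> \<eta> \<eta> thesis] by blast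
  have "\<exists>w\<ge>0. \<forall>\<^sub>F l in type_filter xs. a l - b l \<in> thickened_interval w \<epsilon>" if "0 < \<epsilon>" for \<epsilon>
  proof -
    from that have "0 < \<epsilon> / 2" by simp
    with assms obtain u v where uv: "0 \<le> u" "\<forall>\<^sub>F l in type_filter xs. a l \<in> thickened_interval u (\<epsilon> / 2)"
      "0 \<le> v" "\<forall>\<^sub>F l in type_filter xs. b l \<in> thickened_interval v (\<epsilon> / 2)"
      unfolding eq closed_hull_ideal_iff[OF fin(1)] closed_hull_ideal_iff[OF fin(2)] star_set_pt by meson
    from uv(2,4) have "\<forall>\<^sub>F l in type_filter xs. a l - b l \<in> thickened_interval (u + v) \<epsilon>"
    proof eventually_elim
      case (elim l)
      then show ?case using thickened_interval_diff by fastforce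
    qed
    with uv show ?thesis by (intro exI[of _ "u + v"]) simp
  qed
  then show ?thesis
    by (simp add: eq hull_minus_hat fin closed_hull_ideal_iff fin_diff star_set_pt)
qed

lemma equiv_check: "equiv (nonstd_hull U e) (cong_mod U e (closed_hull_ideal U e))"
  by (rule equiv_cong_mod) (auto simp: hull_of_in_closed_hull_ideal closed_hull_ideal_diff)

end

section \<open>AM-compact operators\<close>

lemma compact_closure_iff_totally_bounded:
  fixes S :: "'a::complete_space set"
  shows "compact (closure S) \<longleftrightarrow> (\<forall>\<epsilon>>0. \<exists>K. finite K \<and> S \<subseteq> (\<Union>k\<in>K. ball k \<epsilon>))"
proof
  assume "compact (closure S)"
  then show "\<forall>\<epsilon>>0. \<exists>K. finite K \<and> S \<subseteq> (\<Union>k\<in>K. ball k \<epsilon>)"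
    unfolding compact_eq_totally_bounded using closure_subset[of S] by (meson order_trans)
next
  assume tb: "\<forall>\<epsilon>>0. \<exists>K. finite K \<and> S \<subseteq> (\<Union>k\<in>K. ball k \<epsilon>)"
  have "\<exists>K. finite K \<and> closure S \<subseteq> (\<Union>k\<in>K. ball k \<epsilon>)" if pos: "0 < \<epsilon>" for \<epsilon>
  proof -
    obtain K where K: "finite K" "S \<subseteq> (\<Union>k\<in>K. ball k (\<epsilon> / 2))"
      using tb half_gt_zero[OF pos] by blast
    \<comment> \<open>A finite union of closed balls is closed, so it also covers the closure; the
      halved radius lets the closed balls fit into the open ones.\<close>
    have "S \<subseteq> (\<Union>k\<in>K. cball k (\<epsilon> / 2))" using K(2) ball_subset_cball by blast
    then have "closure S \<subseteq> (\<Union>k\<in>K. cball k (\<epsilon> / 2))"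
      using K(1) by (intro closure_minimal closed_UN) auto
    also have "\<dots> \<subseteq> (\<Union>k\<in>K. ball k \<epsilon>)" using pos by (intro UN_mono) auto
    finally show ?thesis using K(1) by blast
  qed
  then show "compact (closure S)"
    by (simp add: compact_eq_totally_bounded complete_eq_closed)
qed

context nonstandard
begin

text \<open>For each radius the ultrafilter selects one ball of the finite cover. The selected
  centres form a Cauchy sequence, and completeness supplies the limit.\<close>

lemma ultrafilter_totally_bounded_convergent:
  fixes g :: "'u list \<Rightarrow> 'c::complete_space"
  assumes "\<And>\<epsilon>. 0 < \<epsilon> \<Longrightarrow> \<exists>K. finite K \<and> (\<forall>\<^sub>F l in type_filter xs. \<exists>k\<in>K. dist (g l) k < \<epsilon>)"
  shows "\<exists>z. (g \<longlongrightarrow> z) (type_filter xs)"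
proof -
  have "\<exists>k. \<forall>\<^sub>F l in type_filter xs. dist (g l) k < \<epsilon>" if "0 < \<epsilon>" for \<epsilon>
  proof (rule ccontr)
    \<comment> \<open>If no single ball were an event, all the complements would be, and so would
      their finite intersection, against the cover.\<close>
    assume no: "\<nexists>k. \<forall>\<^sub>F l in type_filter xs. dist (g l) k < \<epsilon>"
    obtain K where K: "finite K" "\<forall>\<^sub>F l in type_filter xs. \<exists>k\<in>K. dist (g l) k < \<epsilon>"
      using assms \<open>0 < \<epsilon>\<close> by blast
    have "\<forall>\<^sub>F l in type_filter xs. \<forall>k\<in>K. \<not> dist (g l) k < \<epsilon>"
      using no K(1) by (intro eventually_ball_finite) (auto simp: type_filter_not)
    with K(2) have "\<forall>\<^sub>F l in type_filter xs. False" by eventually_elim blast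
    then show False by (simp add: eventually_False type_filter_neq_bot)
  qed
  then have "\<forall>n. \<exists>k. \<forall>\<^sub>F l in type_filter xs. dist (g l) k < inverse (real (Suc n))" by simp
  then obtain k where k: "\<And>n. \<forall>\<^sub>F l in type_filter xs. dist (g l) (k n) < inverse (real (Suc n))"
    by metis
  have dist_k: "dist (k m) (k n) < inverse (real (Suc m)) + inverse (real (Suc n))" for m n
  proof -
    \<comment> \<open>Two events of a proper filter meet, and any common list bounds the distance of
      the centres.\<close>
    from k[of m] k[of n] have "\<forall>\<^sub>F l in type_filter xs.
        dist (k m) (k n) < inverse (real (Suc m)) + inverse (real (Suc n))"
      by eventually_elim (use dist_triangle3 in \<open>smt (verit)\<close>)
    then show ?thesis by (simp add: type_filter_neq_bot)
  qed
  have small: "inverse (real (Suc n)) < \<epsilon>" if "N \<le> n" "inverse (real (Suc N)) < \<epsilon>" for n N \<epsilon>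
    using that(1) by (intro le_less_trans[OF _ that(2)] le_imp_inverse_le) auto
  have "Cauchy k"
  proof (rule metric_CauchyI)
    fix \<epsilon> :: real assume "0 < \<epsilon>"
    then obtain N where N: "inverse (real (Suc N)) < \<epsilon> / 2" using reals_Archimedean half_gt_zero by blast
    have "dist (k m) (k n) < \<epsilon>" if "N \<le> m" "N \<le> n" for m n
      using dist_k[of m n] small[OF that(1) N] small[OF that(2) N] by simp
    then show "\<exists>N. \<forall>m\<ge>N. \<forall>n\<ge>N. dist (k m) (k n) < \<epsilon>" by blast
  qed
  then obtain z where z: "k \<longlonglongrightarrow> z" by (metis Cauchy_convergent convergent_def)
  have "\<forall>\<^sub>F l in type_filter xs. dist (g l) z < \<epsilon>" if "0 < \<epsilon>" for \<epsilon>
  proof -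
    have pos: "0 < \<epsilon> / 2" using that by simp
    obtain N where N: "inverse (real (Suc N)) < \<epsilon> / 2" using reals_Archimedean[OF pos] by blast
    obtain M where M: "\<And>n. M \<le> n \<Longrightarrow> dist (k n) z < \<epsilon> / 2" using z pos unfolding lim_sequentially by blast
    let ?n = "max M N"
    show ?thesis
      using k[of ?n]
    proof eventually_elim
      case (elim l)
      have "dist (k ?n) z < \<epsilon> / 2" by (rule M) simp
      moreover have "inverse (real (Suc ?n)) < \<epsilon> / 2" by (rule small[OF _ N]) simp
      ultimately show ?case using elim dist_triangle[of "g l" z "k ?n"] by linarith
    qed
  qed
  then show ?thesis by (auto simp: tendsto_iff)
qed

section \<open>Internal sets and saturation\<close>

lemma star_set_mono:
  assumes "A \<subseteq> B"
  shows "star_set U A \<subseteq> star_set U B"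
proof
  fix x
  have "x \<in> star_set U C \<longleftrightarrow> (\<forall>\<^sub>F l in type_filter [x]. l ! 0 \<in> C)" for C
    using star_set_val[of "[x]" "\<lambda>l. l ! 0" C] by (simp add: val_proj[of 0 "[x]", simplified])
  then show "x \<in> star_set U A \<Longrightarrow> x \<in> star_set U B"
    using assms by (auto elim: eventually_mono)
qed

text \<open>By \<open>embedded\<close>, some object of the universe has the image of
  \<open>A\<close> as its elements; its star is the parameter that witnesses internality.\<close>

lemma internal_star_set:
  assumes "embedded U e"
  shows "internal U (star_set U (e ` A))"
proof -
  obtain s where s: "\<And>x. elem U x s \<longleftrightarrow> x \<in> e ` A"
    using assms unfolding embedded_def by blast
  have "x \<in> star_set U (e ` A) \<longleftrightarrow> star_rel U (elem U) x (star U s)" for x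
    using star_set_val[of "[x]" "\<lambda>l. l ! 0" "e ` A"]
      star_rel_val[of "elem U" "[x]" "\<lambda>l. l ! 0" "\<lambda>_. s"]
    by (simp add: s val_proj[of 0 "[x]", simplified] val_const)
  then show ?thesis unfolding internal_def by blast
qed

text \<open>Saturation takes families indexed by the elements of an object of the universe. The
  index type is therefore coded by \<open>f\<close>, and the object with elements
  \<open>range f\<close> serves as index set.\<close>

lemma saturation:
  fixes e :: "'x \<Rightarrow> 'u" and f :: "'i \<Rightarrow> 'u" and B :: "'i \<Rightarrow> 'x set"
  assumes e: "embedded U e" and f: "embedded U f"
    and fip: "\<And>K. finite K \<Longrightarrow> (\<Inter>k\<in>K. B k) \<noteq> {}"
  shows "\<exists>x. \<forall>k. x \<in> star_set U (e ` B k)"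
proof -
  obtain s where s: "\<And>i. elem U i s \<longleftrightarrow> i \<in> range f"
    using f unfolding embedded_def by blast
  let ?A = "\<lambda>i. star_set U (e ` B (inv f i))"
  have sat: "saturated U" using nonstandard_universe by (simp add: nonstandard_universe_def)
  have internal: "\<forall>i. elem U i s \<longrightarrow> internal U (?A i)" using internal_star_set[OF e] by blast
  have "(\<Inter>i\<in>J. ?A i) \<noteq> {}" if J: "finite J" for J
  proof -
    \<comment> \<open>A common point of finitely many standard sets yields, through its star, a
      common point of their extensions.\<close>
    obtain w where "\<And>i. i \<in> J \<Longrightarrow> w \<in> B (inv f i)"
      using fip[of "inv f ` J"] J by auto
    then have "\<And>i. i \<in> J \<Longrightarrow> star U (e w) \<in> ?A i"
      by (simp add: val_const[symmetric, of _ "[]"] star_set_val)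
    then show ?thesis by blast
  qed
  then have "\<forall>J. finite J \<longrightarrow> J \<subseteq> {i. elem U i s} \<longrightarrow> (\<Inter>i\<in>J. ?A i) \<noteq> {}" by simp
  with spec[OF spec[OF sat[unfolded saturated_def], of s], of ?A] internal
  have "(\<Inter>i\<in>{i. elem U i s}. ?A i) \<noteq> {}" by (simp only: simp_thms)
  then obtain x where x: "\<And>i. i \<in> range f \<Longrightarrow> x \<in> ?A i" by (auto simp: s)
  have "x \<in> star_set U (e ` B k)" for k
    using x[of "f k"] f by (simp add: embedded_def)
  then show ?thesis by blast
qed

end

section \<open>The operator induced on the hull\<close>

locale lattice_operator = E: embedded_lattice U e + F: embedded_lattice U f
  for U :: "('u, 's) universe"
    and e :: "'a::banach_lattice complexification \<Rightarrow> 'u"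
    and f :: "'b::banach_lattice complexification \<Rightarrow> 'u" +
  fixes T :: "'a complexification \<Rightarrow> 'b complexification"
  assumes bounded_clinear: "bounded_clinear T"
begin

lemma bounded_linear: "bounded_linear T"
  using bounded_clinear by (simp add: bounded_clinear_def)

lemma T_diff: "T (z - w) = T z - T w"
  using bounded_linear by (simp add: linear_diff bounded_linear.linear)

lemma T_zero: "T 0 = 0"
  using bounded_linear by (simp add: linear_0 bounded_linear.linear)

lemma star_op_pt: "star_op U e f T (E.pt xs a) = F.pt xs (\<lambda>l. T (a l))"
  by (simp add: star_op_def E.pt_def F.pt_def E.star_fun_val)

lemma fin_op:
  assumes "E.pt xs a \<in> fin U e"
  shows "F.pt xs (\<lambda>l. T (a l)) \<in> fin U f"
proof -
  obtain K where K: "0 < K" "\<And>z. norm (T z) \<le> norm z * K"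
    using bounded_linear.pos_bounded[OF bounded_linear] by blast
  obtain r where "\<forall>\<^sub>F l in E.type_filter xs. norm (a l) < r" using assms by (auto simp: E.fin_pt)
  then have "\<forall>\<^sub>F l in E.type_filter xs. norm (T (a l)) < r * K"
    by eventually_elim (rule le_less_trans[OF K(2)], simp add: K(1))
  then show ?thesis by (auto simp: F.fin_pt)
qed

lemma hull_op_hat:
  assumes "E.pt xs a \<in> fin U e"
  shows "hull_op U e f T (hat U e (E.pt xs a)) = hat U f (F.pt xs (\<lambda>l. T (a l)))"
proof -
  have "congruent (near U e) (\<lambda>x. hat U f (star_op U e f T x))"
    unfolding congruent_def
  proof (clarify)
    fix x y assume n: "(x, y) \<in> near U e"
    then have "x \<in> fin U e" "y \<in> fin U e" by (auto simp: near_def)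
    then obtain zs a b where *: "x = E.pt zs a" "y = E.pt zs b" by (metis E.obtain_fin3)
    have "((\<lambda>l. T (a l - b l)) \<longlongrightarrow> 0) (E.type_filter zs)"
      using bounded_linear.tendsto_zero[OF bounded_linear] n unfolding * E.near_pt by blast
    then show "hat U f (star_op U e f T x) = hat U f (star_op U e f T y)"
      using n unfolding * by (simp add: E.near_pt star_op_pt F.hat_pt_eq_iff fin_op T_diff)
  qed
  from UN_equiv_class[OF E.equiv_near this assms] show ?thesis
    by (simp add: hull_op_def hat_def[of U e "E.pt xs a"] star_op_pt)
qed

lemma hull_op_in_hull: "\<xi> \<in> nonstd_hull U e \<Longrightarrow> hull_op U e f T \<xi> \<in> nonstd_hull U f"
proof -
  assume "\<xi> \<in> nonstd_hull U e"
  then show ?thesis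
  proof (rule E.obtain_hat3)
    fix xs a assume "E.pt xs a \<in> fin U e" "\<xi> = hat U e (E.pt xs a)"
    then show ?thesis by (simp add: hull_op_hat fin_op F.hat_in_hull)
  qed fact+
qed

lemma hull_op_diff:
  assumes "\<xi> \<in> nonstd_hull U e" "\<eta> \<in> nonstd_hull U e"
  shows "hull_minus U f (hull_op U e f T \<xi>) (hull_op U e f T \<eta>) = hull_op U e f T (hull_minus U e \<xi> \<eta>)"
proof (rule E.obtain_hat3[OF assms assms(2)])
  fix xs a b
  assume "E.pt xs a \<in> fin U e" "E.pt xs b \<in> fin U e"
    "\<xi> = hat U e (E.pt xs a)" "\<eta> = hat U e (E.pt xs b)"
  then show ?thesis
    by (simp add: hull_op_hat fin_op F.hull_minus_hat E.hull_minus_hat E.fin_diff T_diff)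
qed

lemma hull_op_hull_of: "hull_op U e f T (hull_of U e z) = hull_of U f (T z)"
  by (simp add: E.hull_of_pt[of _ "[]"] F.hull_of_pt[of _ "[]"] hull_op_hat E.fin_const)

text \<open>Being infinitely close to the standard point \<open>z\<close> means converging to
  \<open>z\<close>; this is how both implications about AM-compactness read membership in F.\<close>

lemma hull_op_nearstandard_iff:
  assumes "E.pt xs a \<in> fin U e"
  shows "hull_op U e f T (hat U e (E.pt xs a)) \<in> range (hull_of U f) \<longleftrightarrow>
    (\<exists>z. ((\<lambda>l. T (a l)) \<longlongrightarrow> z) (E.type_filter xs))"
  using assms
  by (auto simp: hull_op_hat F.hull_of_pt[of _ xs] F.hat_pt_eq_iff fin_op F.fin_const LIM_zero_iff)

section \<open>AM-compactness and the image of the closed ideal\<close>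

lemma AM_compact_maps_ideal:
  assumes AM: "AM_compact T" and I: "\<xi> \<in> closed_hull_ideal U e"
  shows "hull_op U e f T \<xi> \<in> range (hull_of U f)"
proof -
  have \<xi>: "\<xi> \<in> nonstd_hull U e" using I E.closed_hull_ideal_subset by blast
  obtain xs a where fin: "E.pt xs a \<in> fin U e" and eq: "\<xi> = hat U e (E.pt xs a)"
    using E.obtain_hat3[OF \<xi> \<xi> \<xi>, of thesis] by blast
  obtain C where C: "0 < C" "\<And>z. norm (T z) \<le> norm z * C"
    using bounded_linear.pos_bounded[OF bounded_linear] by blast
  have "\<exists>K. finite K \<and> (\<forall>\<^sub>F l in E.type_filter xs. \<exists>k\<in>K. dist (T (a l)) k < \<epsilon>)"
    if "0 < \<epsilon>" for \<epsilon>
  proof -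
    \<comment> \<open>Since \<open>C\<close> bounds \<open>T\<close>, points within \<epsilon>/2/C
      of the interval have images within \<epsilon>/2 of its image; the other \<epsilon>/2 is the
      radius of the net.\<close>
    have pos: "0 < \<epsilon> / 2" "0 < \<epsilon> / 2 / C" using that C(1) by simp_all
    obtain u where u: "0 \<le> u" "\<forall>\<^sub>F l in E.type_filter xs. a l \<in> thickened_interval u (\<epsilon> / 2 / C)"
      using I pos(2) unfolding eq E.closed_hull_ideal_iff[OF fin] E.star_set_pt by blast
    have "compact (closure (T ` order_interval u))" using AM u(1) by (simp add: AM_compact_def)
    then obtain K where K: "finite K" "T ` order_interval u \<subseteq> (\<Union>k\<in>K. ball k (\<epsilon> / 2))"
      using pos(1) unfolding compact_closure_iff_totally_bounded by blast
    from u(2) have "\<forall>\<^sub>F l in E.type_filter xs. \<exists>k\<in>K. dist (T (a l)) k < \<epsilon>"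
    proof eventually_elim
      case (elim l)
      then obtain w where w: "w \<in> order_interval u" "norm (a l - w) < \<epsilon> / 2 / C"
        by (auto simp: thickened_interval_def)
      then obtain k where k: "k \<in> K" "dist k (T w) < \<epsilon> / 2" using K(2) by auto
      have "norm (a l - w) * C < \<epsilon> / 2" using w(2) C(1) by (simp add: pos_less_divide_eq)
      then have "dist (T (a l)) (T w) < \<epsilon> / 2"
        using C(2)[of "a l - w"] by (simp add: dist_norm T_diff)
      then have "dist (T (a l)) k < \<epsilon>"
        using k(2) dist_triangle[of "T (a l)" k "T w"] by (simp add: dist_commute)
      with k(1) show ?case by blast
    qed
    with K(1) show ?thesis by blast
  qed
  then show ?thesis
    unfolding eq hull_op_nearstandard_iff[OF fin] by (rule E.ultrafilter_totally_bounded_convergent)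
qed

lemma maps_ideal_AM_compact:
  assumes "order_bounded T"
    and maps: "\<And>\<xi>. \<xi> \<in> closed_hull_ideal U e \<Longrightarrow> hull_op U e f T \<xi> \<in> range (hull_of U f)"
  shows "AM_compact T"
  unfolding AM_compact_def compact_closure_iff_totally_bounded
proof (intro conjI allI impI)
  fix u :: 'a and \<epsilon> :: real assume u: "0 \<le> u" and \<epsilon>: "0 < \<epsilon>"
  show "\<exists>K. finite K \<and> T ` order_interval u \<subseteq> (\<Union>k\<in>K. ball k \<epsilon>)"
  proof (rule ccontr)
    assume no: "\<nexists>K. finite K \<and> T ` order_interval u \<subseteq> (\<Union>k\<in>K. ball k \<epsilon>)"
    \<comment> \<open>\<open>B k\<close> collects the points of the interval whose image stays at
      distance at least \<epsilon> from \<open>k\<close>. Failure of every finite cover is the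
      finite intersection property; the index \<open>k\<close> runs over all of F, coded by
      \<open>f\<close>.\<close>
    define B where "B = (\<lambda>k. {w \<in> order_interval u. \<epsilon> \<le> dist (T w) k})"
    have "(\<Inter>k\<in>K. B k) \<noteq> {}" if "finite K" for K
    proof -
      have "\<not> T ` order_interval u \<subseteq> (\<Union>k\<in>K. ball k \<epsilon>)" using no that by blast
      then obtain w where "w \<in> order_interval u" "\<And>k. k \<in> K \<Longrightarrow> \<epsilon> \<le> dist (T w) k"
        by (force simp: dist_commute not_less)
      then have "w \<in> (\<Inter>k\<in>K. B k)" by (auto simp: B_def)
      then show ?thesis by blast
    qed
    from E.saturation[OF E.embedded F.embedded this]
    obtain x where x: "\<And>k. x \<in> star_set U (e ` B k)" by blast
    have "x \<in> star_set U (range e)"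
      using x[of 0] E.star_set_mono[of "e ` B 0" "range e"] by blast
    then obtain xs a where a: "x = E.pt xs a" by (metis E.obtain_pt4)
    have aB: "\<forall>\<^sub>F l in E.type_filter xs. a l \<in> B k" for k
      using x[of k] unfolding a E.star_set_pt .
    from aB[of 0] have interval: "\<forall>\<^sub>F l in E.type_filter xs. a l \<in> order_interval u"
      by (rule eventually_mono) (simp add: B_def)
    then have "\<forall>\<^sub>F l in E.type_filter xs. norm (a l) < norm u + 1"
      by eventually_elim (use norm_le_of_order_interval in fastforce)
    then have fin: "E.pt xs a \<in> fin U e" by (auto simp: E.fin_pt)
    have "\<forall>\<^sub>F l in E.type_filter xs. a l \<in> thickened_interval u \<delta>" if "0 < \<delta>" for \<delta>
      using interval
    proof eventually_elim
      case (elim l)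
      then show ?case using that by (auto simp: thickened_interval_def intro!: bexI[of _ "a l"])
    qed
    then have "hat U e (E.pt xs a) \<in> closed_hull_ideal U e"
      using u unfolding E.closed_hull_ideal_iff[OF fin] E.star_set_pt by blast
    from maps[OF this] obtain z where "((\<lambda>l. T (a l)) \<longlongrightarrow> z) (E.type_filter xs)"
      unfolding hull_op_nearstandard_iff[OF fin] by blast
    then have "\<forall>\<^sub>F l in E.type_filter xs. dist (T (a l)) z < \<epsilon>" using \<epsilon> by (simp add: tendsto_iff)
    \<comment> \<open>The limit \<open>z\<close> is itself an index, and \<open>B z\<close> keeps
      the image away from it.\<close>
    with aB[of z] have "\<forall>\<^sub>F l in E.type_filter xs. False"
      by eventually_elim (simp add: B_def)
    then show False by (simp add: eventually_False E.type_filter_neq_bot)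
  qed
qed fact

section \<open>Factorization through the quotients\<close>

lemma tilde_op_class:
  assumes "\<xi> \<in> nonstd_hull U e"
  shows "tilde_op U e f T (cong_mod U e (range (hull_of U e)) `` {\<xi>}) =
    cong_mod U f (range (hull_of U f)) `` {hull_op U e f T \<xi>}"
proof -
  have "congruent (cong_mod U e (range (hull_of U e)))
      (\<lambda>\<xi>. cong_mod U f (range (hull_of U f)) `` {hull_op U e f T \<xi>})"
    unfolding congruent_def
  proof (clarify)
    fix \<xi> \<eta> assume "(\<xi>, \<eta>) \<in> cong_mod U e (range (hull_of U e))"
    \<comment> \<open>A difference in E goes to a difference in F, because the hull operator sends
      the class of a standard \<open>z\<close> to that of \<open>T z\<close>.\<close>
    then have "(hull_op U e f T \<xi>, hull_op U e f T \<eta>) \<in> cong_mod U f (range (hull_of U f))"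
      by (auto simp: cong_mod_def hull_op_diff hull_op_in_hull hull_op_hull_of)
    then show "cong_mod U f (range (hull_of U f)) `` {hull_op U e f T \<xi>} =
        cong_mod U f (range (hull_of U f)) `` {hull_op U e f T \<eta>}"
      by (rule equiv_class_eq[OF F.equiv_tilde])
  qed
  from UN_equiv_class[OF E.equiv_tilde this assms] show ?thesis by (simp add: tilde_op_def)
qed

lemma canonical_epi_class:
  assumes "\<xi> \<in> nonstd_hull U e"
  shows "canonical_epi U e (cong_mod U e (range (hull_of U e)) `` {\<xi>}) =
    cong_mod U e (closed_hull_ideal U e) `` {\<xi>}"
proof -
  have "congruent (cong_mod U e (range (hull_of U e)))
      (\<lambda>\<xi>. cong_mod U e (closed_hull_ideal U e) `` {\<xi>})"
    unfolding congruent_def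
  proof (clarify)
    fix \<xi> \<eta> assume "(\<xi>, \<eta>) \<in> cong_mod U e (range (hull_of U e))"
    then have "(\<xi>, \<eta>) \<in> cong_mod U e (closed_hull_ideal U e)"
      by (auto simp: cong_mod_def E.hull_of_in_closed_hull_ideal)
    then show "cong_mod U e (closed_hull_ideal U e) `` {\<xi>} = cong_mod U e (closed_hull_ideal U e) `` {\<eta>}"
      by (rule equiv_class_eq[OF E.equiv_check])
  qed
  from UN_equiv_class[OF E.equiv_tilde this assms] show ?thesis by (simp add: canonical_epi_def)
qed

lemma maps_ideal_iff_factors:
  "hull_op U e f T ` closed_hull_ideal U e \<subseteq> range (hull_of U f) \<longleftrightarrow>
    (\<exists>Tbar. Tbar \<in> check_space U e \<rightarrow> tilde_space U f \<and>
       (\<forall>X\<in>tilde_space U e. tilde_op U e f T X = Tbar (canonical_epi U e X)))"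
    (is "?maps \<longleftrightarrow> ?factors")
proof
  assume maps: ?maps
  let ?c = "\<lambda>\<xi>. cong_mod U f (range (hull_of U f)) `` {hull_op U e f T \<xi>}"
  let ?r = "cong_mod U e (closed_hull_ideal U e)"
  \<comment> \<open>The union has a single value on each class, because a difference in the closed
    ideal is mapped into F.\<close>
  define Tbar where "Tbar = (\<lambda>Y. \<Union>\<xi>\<in>Y. ?c \<xi>)"
  have "congruent ?r ?c"
    unfolding congruent_def
  proof (clarify)
    fix \<xi> \<eta> assume "(\<xi>, \<eta>) \<in> ?r"
    then have "(hull_op U e f T \<xi>, hull_op U e f T \<eta>) \<in> cong_mod U f (range (hull_of U f))"
      using maps by (auto simp: cong_mod_def hull_op_diff hull_op_in_hull)
    then show "?c \<xi> = ?c \<eta>" by (rule equiv_class_eq[OF F.equiv_tilde])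
  qed
  from UN_equiv_class[OF E.equiv_check this]
  have Tbar: "Tbar (?r `` {\<xi>}) = ?c \<xi>" if "\<xi> \<in> nonstd_hull U e" for \<xi>
    using that by (simp add: Tbar_def)
  have "Tbar Y \<in> tilde_space U f" if "Y \<in> check_space U e" for Y
    using that unfolding check_space_def
  proof (rule quotientE)
    fix \<xi> assume "Y = ?r `` {\<xi>}" "\<xi> \<in> nonstd_hull U e"
    then show ?thesis by (simp add: Tbar tilde_space_def quotientI hull_op_in_hull)
  qed
  moreover have "tilde_op U e f T X = Tbar (canonical_epi U e X)" if "X \<in> tilde_space U e" for X
    using that unfolding tilde_space_def
  proof (rule quotientE)
    fix \<xi> assume "X = cong_mod U e (range (hull_of U e)) `` {\<xi>}" "\<xi> \<in> nonstd_hull U e"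
    then show ?thesis by (simp add: tilde_op_class canonical_epi_class Tbar)
  qed
  ultimately show ?factors by blast
next
  assume ?factors
  then obtain Tbar where Tbar: "\<And>X. X \<in> tilde_space U e \<Longrightarrow>
      tilde_op U e f T X = Tbar (canonical_epi U e X)" by blast
  let ?t = "\<lambda>\<xi>. cong_mod U e (range (hull_of U e)) `` {\<xi>}"
  show ?maps
  proof (rule image_subsetI)
    fix \<xi> assume I: "\<xi> \<in> closed_hull_ideal U e"
    then have \<xi>: "\<xi> \<in> nonstd_hull U e" using E.closed_hull_ideal_subset by blast
    \<comment> \<open>\<open>Tbar\<close> is only a map, so its value on the class of \<xi> is found
      by comparison: \<xi> and 0 have the same class modulo the closed ideal, and the factorization
      fixes the value at the class of 0.\<close>
    let ?z = "hull_of U e 0"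
    have z: "?z \<in> nonstd_hull U e" by (rule E.hull_of_in_hull)
    have "(\<xi>, ?z) \<in> cong_mod U e (closed_hull_ideal U e)"
      using I \<xi> z by (simp add: cong_mod_def E.hull_minus_zero)
    then have "canonical_epi U e (?t \<xi>) = canonical_epi U e (?t ?z)"
      using \<xi> z by (simp add: canonical_epi_class equiv_class_eq[OF E.equiv_check])
    moreover have "?t \<xi> \<in> tilde_space U e" "?t ?z \<in> tilde_space U e"
      using \<xi> z by (simp_all add: tilde_space_def quotientI)
    ultimately have "tilde_op U e f T (?t \<xi>) = tilde_op U e f T (?t ?z)" using Tbar by simp
    then have "(hull_op U e f T \<xi>, hull_op U e f T ?z) \<in> cong_mod U f (range (hull_of U f))"
      using \<xi> z by (simp add: tilde_op_class eq_equiv_class_iff[OF F.equiv_tilde] hull_op_in_hull)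
    then show "hull_op U e f T \<xi> \<in> range (hull_of U f)"
      using hull_op_in_hull[OF \<xi>]
      by (simp add: cong_mod_def hull_op_hull_of T_zero F.hull_minus_zero)
  qed
qed

end

theorem theorem13:
  fixes U :: "('u, 's) universe"
    and e :: "'a::banach_lattice complexification \<Rightarrow> 'u"
    and f :: "'b::banach_lattice complexification \<Rightarrow> 'u"
    and T :: "'a complexification \<Rightarrow> 'b complexification"
  assumes "nonstandard_universe U" and "embedded U e" and "embedded U f"
    and "bounded_clinear T" and "order_bounded T"
  shows "(AM_compact T \<longleftrightarrow> hull_op U e f T ` closed_hull_ideal U e \<subseteq> range (hull_of U f)) \<and>
    (AM_compact T \<longleftrightarrow>
      (\<exists>Tbar. Tbar \<in> check_space U e \<rightarrow> tilde_space U f \<and>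
         (\<forall>X\<in>tilde_space U e. tilde_op U e f T X = Tbar (canonical_epi U e X))))"
proof -
  interpret lattice_operator U e f T
    using assms by unfold_locales
  have "AM_compact T \<longleftrightarrow> hull_op U e f T ` closed_hull_ideal U e \<subseteq> range (hull_of U f)"
    using AM_compact_maps_ideal maps_ideal_AM_compact[OF assms(5)] by blast
  then show ?thesis using maps_ideal_iff_factors by simp
qed

end
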